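(* Let $r\in[2,\infty)$ and let $(\gamma_\alpha)$, indexed by the multi-indices $\alpha\in\bigcup_{n\in\mathbb{N}}\mathbb{N}_0^n$, be a family of (real or complex) subgaussian random variables with $s=\sup_\alpha\mathrm{sg}(\gamma_\alpha)<\infty$ and, if $r>2$, also $M=\sup_\alpha\|\gamma_\alpha\|_\infty<\infty$. Then there is a constant $C_r>0$, depending only on $s$ if $r=2$ and only on $r,s,M$ if $r>2$, such that for all positive integers $m,n$, every Banach space $X=(\mathbb{C}^n,\|\cdot\|)$, and every random polynomial $\sum_{|\alpha|\le m}\gamma_\alpha c_\alpha z^\alpha\in\mathcal{P}_m(X)$ (where $c_\alpha\in\mathbb{C}$, $\alpha\in\mathbb{N}_0^n$), $$\Big\|\sup_{z\in B_X}\Big|\sum_{|\alpha|\le m}\gamma_\alpha c_\alpha z^\alpha\Big|\Big\|_{L_{\varphi_r}}\le C_r\big(n(1+\log m)\big)^{\frac1r}\bigg(\sum_{k=0}^m\ \sup_{|\alpha|=k}\frac{|c_\alpha|^{r'}\alpha!}{k!}\ \sup_{z\in B_X}\Big(\sum_{i=1}^n|z_i|^{r'}\Big)^k\bigg)^{\frac1{r'}}.$$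
   Context: A real random variable $f$ is subgaussian if there is $s\ge0$ with $\mathbb{E}\exp(xf)\le\exp(s^2x^2/2)$ for all $x\in\mathbb{R}$; a complex random variable $f$ is subgaussian if there is $s\ge0$ with $\mathbb{E}\exp(\mathrm{Re}(zf))\le\exp(s^2|z|^2/2)$ for all $z\in\mathbb{C}$. The best such $s$ is denoted $\mathrm{sg}(f)$. All random variables live on a probability space $(\Omega,\mathcal{A},\mathbb{P})$. For $1\le r<\infty$ let $\varphi_r(t)=e^{t^r}-1$ and $\|f\|_{L_{\varphi_r}}=\inf\{\varepsilon>0:\int_\Omega\varphi_r(|f|/\varepsilon)\,d\mathbb{P}\le1\}$. Here $1/r+1/r'=1$. $B_X$ is the closed unit ball of $X$; $|\alpha|=\alpha_1+\dots+\alpha_n$, $\alpha!=\alpha_1!\cdots\alpha_n!$, $z^\alpha=z_1^{\alpha_1}\cdots z_n^{\alpha_n}$. $\mathcal{P}_m(X)$ is the space of polynomials on $X$ of degree at most $m$.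
   Formalization: The random variables γ_α are assumed independent: without this the estimate fails (all γ_α one Rademacher variable, c_α=√(m!/α!) for |α|=m, n=2, Euclidean norm). The constant is stated per underlying set Ω; uniformity over all Ω follows by passing to the law of the family. *)

theory Defs
  imports "HOL-Probability.Probability"
begin

section \<open>Subgaussian random variables\<close>

text \<open>
  A random variable is a complex-valued function; a real random variable is one whose values are
  real, and for it only the one-parameter (real) subgaussian condition is imposed. Expectations of
  nonnegative functions are \<^term>\<open>nn_integral\<close>s, so that each of the inequalities below
  includes the finiteness of its left-hand side (a non-integrable function would have Bochner
  integral 0).

  The theorem assumes the random variables \<open>\<gamma>\<^sub>\<alpha>\<close> to be independent; the source does
  not state this. Without independence the estimate fails: take \<open>r = 2\<close>, \<open>n = 2\<close>, the Euclidean norm,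
  all \<open>\<gamma>\<^sub>\<alpha>\<close> equal to one Rademacher variable, \<open>c\<^sub>\<alpha> = sqrt (m! / \<alpha>!)\<close> for
  \<open>\<bar>\<alpha>\<bar> = m\<close> and \<open>c\<^sub>\<alpha> = 0\<close> otherwise; the left-hand side is at least a constant times
  \<open>m powr (1/4)\<close> (evaluate at \<open>z = (1/sqrt 2, 1/sqrt 2)\<close>), and the right-hand side is
  \<open>C * sqrt (2 * (1 + ln m))\<close>.
\<close>

definition subgaussian_bounds :: "'a measure \<Rightarrow> ('a \<Rightarrow> complex) \<Rightarrow> real set" where
  "subgaussian_bounds P f =
     (if f ` space P \<subseteq> \<real>
      then {s. 0 \<le> s \<and> (\<forall>x::real.
             (\<integral>\<^sup>+ \<omega>. ennreal (exp (x * Re (f \<omega>))) \<partial>P) \<le> ennreal (exp (s\<^sup>2 * x\<^sup>2 / 2)))}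
      else {s. 0 \<le> s \<and> (\<forall>z::complex.
             (\<integral>\<^sup>+ \<omega>. ennreal (exp (Re (z * f \<omega>))) \<partial>P) \<le> ennreal (exp (s\<^sup>2 * (cmod z)\<^sup>2 / 2)))})"

definition subgaussian :: "'a measure \<Rightarrow> ('a \<Rightarrow> complex) \<Rightarrow> bool" where
  "subgaussian P f \<longleftrightarrow> f \<in> borel_measurable P \<and> subgaussian_bounds P f \<noteq> {}"

definition sg :: "'a measure \<Rightarrow> ('a \<Rightarrow> complex) \<Rightarrow> real" where
  "sg P f = Inf (subgaussian_bounds P f)"

definition Linfty_norm :: "'a measure \<Rightarrow> ('a \<Rightarrow> complex) \<Rightarrow> ereal" where
  "Linfty_norm P f = esssup P (\<lambda>\<omega>. ereal (cmod (f \<omega>)))"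


section \<open>The Orlicz norm for \<open>exp (t\<^sup>r) - 1\<close>\<close>

definition phi :: "real \<Rightarrow> real \<Rightarrow> real" where
  "phi r t = exp (t powr r) - 1"

text \<open>The value is \<open>\<infinity>\<close> if no \<open>\<epsilon>\<close> is admissible.\<close>

definition orlicz_norm :: "real \<Rightarrow> 'a measure \<Rightarrow> ('a \<Rightarrow> real) \<Rightarrow> ennreal" where
  "orlicz_norm r P f =
     Inf {ennreal \<epsilon> | \<epsilon>. \<epsilon> > 0 \<and> (\<integral>\<^sup>+ \<omega>. ennreal (phi r (\<bar>f \<omega>\<bar> / \<epsilon>)) \<partial>P) \<le> 1}"


section \<open>Multi-indices\<close>

text \<open>
  An element of \<open>\<nat>\<^sub>0\<^sup>n\<close> is a list of length \<open>n\<close>, so that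
  multi-indices of different lengths are different, also when they agree up to trailing zeros.
\<close>

definition multi_indices :: "nat list set" where
  "multi_indices = (\<Union>n\<in>{1..}. {\<alpha>. length \<alpha> = n})"

definition multi_fact :: "nat list \<Rightarrow> real" where
  "multi_fact \<alpha> = (\<Prod>i<length \<alpha>. fact (\<alpha> ! i))"

definition monomial :: "nat list \<Rightarrow> (nat \<Rightarrow> complex) \<Rightarrow> complex" where
  "monomial \<alpha> z = (\<Prod>i<length \<alpha>. z i ^ (\<alpha> ! i))"


section \<open>Norms on \<open>\<complex>\<^sup>n\<close>\<close>

text \<open>
  Since \<open>n\<close> is quantified inside the theorem, vectors of \<open>\<complex>\<^sup>n\<close> are functions on
  \<^typ>\<open>nat\<close> that vanish outside \<open>{..<n}\<close>; coordinates are numbered from 0. Every norm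
  on \<open>\<complex>\<^sup>n\<close> is complete, so no separate completeness assumption appears.
\<close>

definition cvec :: "nat \<Rightarrow> (nat \<Rightarrow> complex) set" where
  "cvec n = {z. \<forall>i\<ge>n. z i = 0}"

definition is_norm :: "nat \<Rightarrow> ((nat \<Rightarrow> complex) \<Rightarrow> real) \<Rightarrow> bool" where
  "is_norm n N \<longleftrightarrow>
     (\<forall>z\<in>cvec n. 0 \<le> N z) \<and>
     (\<forall>z\<in>cvec n. N z = 0 \<longleftrightarrow> z = (\<lambda>i. 0)) \<and>
     (\<forall>a. \<forall>z\<in>cvec n. N (\<lambda>i. a * z i) = cmod a * N z) \<and>
     (\<forall>z\<in>cvec n. \<forall>w\<in>cvec n. N (\<lambda>i. z i + w i) \<le> N z + N w)"

definition unit_ball :: "nat \<Rightarrow> ((nat \<Rightarrow> complex) \<Rightarrow> real) \<Rightarrow> (nat \<Rightarrow> complex) set" where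
  "unit_ball n N = {z \<in> cvec n. N z \<le> 1}"

end

theory Submission
  imports Defs "HOL-Complex_Analysis.Conformal_Mappings"
begin

text \<open>
  A ball of an \<open>n\<close>-dimensional complex norm has a \<open>\<delta>\<close>-net of at most \<open>(4/\<delta>)\<^bsup>2n\<^esup>\<close> points, and a
  polynomial of degree at most \<open>m\<close> oscillates on balls of radius \<open>1/(12m)\<close> by at most half of its
  supremum. So the supremum over \<open>B\<^sub>X\<close> is at most twice the maximum over \<open>exp (O (n (1 + ln m)))\<close>
  points, and a maximum over \<open>L\<close> points costs a factor \<open>(1 + ln L) powr (1/r)\<close> in the
  \<open>L\<^bsub>\<phi>\<^sub>r\<^esub>\<close>-norm. At a fixed point \<open>z\<close> the sum has tails \<open>exp (-c t\<^sup>r)\<close> on the scale of the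
  \<open>\<ell>\<^bsub>r'\<^esub>\<close>-norm of \<open>(c\<^sub>\<alpha> z\<^sup>\<alpha>)\<close>, and by the multinomial theorem this norm is bounded by the
  last factor of the estimate.
\<close>

section \<open>Nets in the unit ball\<close>

text \<open>The constant must not depend on the norm. Comparing \<open>N\<close> with the
  coordinates costs a factor that varies with \<open>N\<close>, so such comparisons enter only
  through finiteness, or in a bound whose bad constant disappears on taking high powers. The net
  depends on \<open>n\<close>, \<open>m\<close> and \<open>N\<close> alone and is fixed before any
  coefficients. Hence one finite set serves all outcomes \<omega>, and the supremum over the ball is
  dominated pointwise by a maximum of finitely many measurable functions, which is enough because
  \<open>nn_integral\<close> is monotone without measurability. For coefficients in the unit ball of
  l_r' the order r of the tails lies between two extremes: absolute summation of bounded variables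
  (l_1) and subgaussian concentration (l_2). Concentration alone gives only tails of order 2. For r
  > 2 the large coefficients are removed first, and there boundedness enters; at r = 2 nothing is
  removed, which keeps M out of the constant.\<close>

lemma cvec_add: "z \<in> cvec n \<Longrightarrow> w \<in> cvec n \<Longrightarrow> (\<lambda>i. z i + w i) \<in> cvec n"
  and cvec_diff: "z \<in> cvec n \<Longrightarrow> w \<in> cvec n \<Longrightarrow> (\<lambda>i. z i - w i) \<in> cvec n"
  and cvec_scale: "z \<in> cvec n \<Longrightarrow> (\<lambda>i. a * z i) \<in> cvec n"
  and cvec_0: "(\<lambda>i. 0) \<in> cvec n"
  by (auto simp: cvec_def)

locale cnorm =
  fixes n :: nat and N :: "(nat \<Rightarrow> complex) \<Rightarrow> real"
  assumes is_norm: "is_norm n N"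
begin

lemma nonneg: "z \<in> cvec n \<Longrightarrow> 0 \<le> N z"
  and eq_0_iff: "z \<in> cvec n \<Longrightarrow> N z = 0 \<longleftrightarrow> z = (\<lambda>i. 0)"
  and scale: "z \<in> cvec n \<Longrightarrow> N (\<lambda>i. a * z i) = cmod a * N z"
  and triangle: "z \<in> cvec n \<Longrightarrow> w \<in> cvec n \<Longrightarrow> N (\<lambda>i. z i + w i) \<le> N z + N w"
  using is_norm by (auto simp: is_norm_def)

lemma zero [simp]: "N (\<lambda>i. 0) = 0"
  using eq_0_iff[OF cvec_0] by simp

lemma diff_commute: 
  assumes "z \<in> cvec n" "w \<in> cvec n"
  shows "N (\<lambda>i. z i - w i) = N (\<lambda>i. w i - z i)"
  using scale[OF cvec_diff[OF assms], of "-1"] by simp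

lemma triangle_diff:
  assumes "z \<in> cvec n" "w \<in> cvec n"
  shows "N (\<lambda>i. z i - w i) \<le> N z + N w"
  using triangle[OF assms(1) cvec_scale[OF assms(2), of "-1"]] scale[OF assms(2), of "-1"] by simp

lemma N_le_add_diff:
  assumes "z \<in> cvec n" "w \<in> cvec n"
  shows "N z \<le> N w + N (\<lambda>i. z i - w i)"
  using triangle[OF assms(2) cvec_diff[OF assms]] by simp

section \<open>Comparison of the norm with the coordinates\<close>

definition unit_vec :: "nat \<Rightarrow> nat \<Rightarrow> complex" where
  "unit_vec i = (\<lambda>j. if j = i then 1 else 0)"

lemma unit_vec_in: "i < n \<Longrightarrow> unit_vec i \<in> cvec n"
  by (auto simp: unit_vec_def cvec_def)

definition unit_sum :: real where
  "unit_sum = (\<Sum>i<n. N (unit_vec i))"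

lemma unit_sum_nonneg: "0 \<le> unit_sum"
  unfolding unit_sum_def by (intro sum_nonneg nonneg unit_vec_in) auto

lemma le_sum_coords:
  assumes "z \<in> cvec n"
  shows "N z \<le> (\<Sum>i<n. cmod (z i) * N (unit_vec i))"
proof -
  have *: "N (\<lambda>j. if j < k then z j else 0) \<le> (\<Sum>i<k. cmod (z i) * N (unit_vec i))" if "k \<le> n" for k
    using that
  proof (induction k)
    case 0
    then show ?case by simp
  next
    case (Suc k)
    define w where "w = (\<lambda>j. if j < k then z j else 0)"
    have w: "w \<in> cvec n" using Suc by (auto simp: w_def cvec_def)
    have u: "unit_vec k \<in> cvec n" using Suc by (intro unit_vec_in) auto
    have "(\<lambda>j. if j < Suc k then z j else 0) = (\<lambda>j. w j + z k * unit_vec k j)"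
      by (auto simp: w_def unit_vec_def fun_eq_iff less_Suc_eq)
    then have "N (\<lambda>j. if j < Suc k then z j else 0) \<le> N w + cmod (z k) * N (unit_vec k)"
      using triangle[OF w cvec_scale[OF u, of "z k"]] scale[OF u, of "z k"] by simp
    then show ?case using Suc by (simp add: w_def)
  qed
  have "(\<lambda>j. if j < n then z j else 0) = z"
    using assms by (auto simp: cvec_def fun_eq_iff)
  with *[of n] show ?thesis by simp
qed

lemma le_coord_bound:
  assumes "z \<in> cvec n" "\<And>i. i < n \<Longrightarrow> cmod (z i) \<le> b"
  shows "N z \<le> b * unit_sum"
proof -
  have "N z \<le> (\<Sum>i<n. b * N (unit_vec i))"
    by (rule order_trans[OF le_sum_coords[OF assms(1)]])
       (intro sum_mono mult_right_mono assms nonneg unit_vec_in, auto)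
  then show ?thesis by (simp add: unit_sum_def sum_distrib_left)
qed

text \<open>Compactness gives this: \<open>N\<close> is continuous and positive on the l_1 unit
  sphere, so it has a positive minimum \<open>N z0\<close> there, and homogeneity carries the bound
  to all vectors. The case \<open>n = 0\<close> is separate because the sphere is then
  empty.\<close>

lemma coord_bound:
  obtains A where "A \<ge> 1" "\<And>z i. z \<in> cvec n \<Longrightarrow> cmod (z i) \<le> A * N z"
proof (cases "n = 0")
  case True
  then have "cmod (z i) \<le> 1 * N z" if "z \<in> cvec n" for z i
    using that nonneg[OF that] by (auto simp: cvec_def)
  then show ?thesis using that[of 1] by auto
next
  case False
  \<comment> \<open>Vectors live in the space of all functions on the naturals with its product
    topology; the factors \<open>{0}\<close> beyond \<open>n\<close> make this box compact by
    Tychonoff's theorem.\<close>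
  define B where "B = PiE (UNIV::nat set) (\<lambda>i. if i < n then cball (0::complex) 1 else {0})"
  define S where "S = B \<inter> {z. (\<Sum>i<n. cmod (z i)) = 1}"
  have "compactin (product_topology (\<lambda>i. euclidean) UNIV) B"
    unfolding B_def by (auto simp: compactin_PiE)
  then have "compact B" by (simp add: euclidean_product_topology)
  moreover have "closed {z :: nat \<Rightarrow> complex. (\<Sum>i<n. cmod (z i)) = 1}"
    by (intro closed_Collect_eq continuous_intros continuous_on_product_coordinates)
  ultimately have "compact S" unfolding S_def by (rule compact_Int_closed)
  have cvecS: "z \<in> cvec n" if "z \<in> S" for z
    using that by (auto simp: S_def B_def cvec_def PiE_iff not_less split: if_splits)
  have contN: "continuous_on S N"
    unfolding continuous_on_def
  proof
    fix z assume z: "z \<in> S"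
    have "((\<lambda>w. \<Sum>i<n. cmod (w i - z i) * N (unit_vec i)) \<longlongrightarrow> (\<Sum>i<n. cmod (z i - z i) * N (unit_vec i))) (at z within S)"
    proof -
      have "continuous_on UNIV (\<lambda>w::nat \<Rightarrow> complex. \<Sum>i<n. cmod (w i - z i) * N (unit_vec i))"
        by (intro continuous_intros continuous_on_product_coordinates)
      then show ?thesis by (meson UNIV_I continuous_on_def tendsto_within_subset top_greatest)
    qed
    then have lim: "((\<lambda>w. \<Sum>i<n. cmod (w i - z i) * N (unit_vec i)) \<longlongrightarrow> 0) (at z within S)" by simp
    have "eventually (\<lambda>w. norm (N w - N z) \<le> (\<Sum>i<n. cmod (w i - z i) * N (unit_vec i))) (at z within S)"
    proof (rule eventually_at_topological[THEN iffD2], intro exI[of _ UNIV] conjI ballI impI)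
      fix w assume "w \<in> S"
      then have w: "w \<in> cvec n" and z': "z \<in> cvec n" using z cvecS by auto
      show "norm (N w - N z) \<le> (\<Sum>i<n. cmod (w i - z i) * N (unit_vec i))"
        using N_le_add_diff[OF w z'] N_le_add_diff[OF z' w] diff_commute[OF w z']
          le_sum_coords[OF cvec_diff[OF w z']] by simp
    qed auto
    then have "((\<lambda>w. N w - N z) \<longlongrightarrow> 0) (at z within S)"
      by (rule Lim_null_comparison[OF _ lim])
    then show "(N \<longlongrightarrow> N z) (at z within S)" by (simp add: LIM_zero_iff)
  qed
  have "unit_vec 0 \<in> S"
    using False by (auto simp: S_def B_def unit_vec_def if_distrib[of cmod] sum.If_cases cong: if_cong)
  then obtain z0 where z0: "z0 \<in> S" "\<And>z. z \<in> S \<Longrightarrow> N z0 \<le> N z"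
    using continuous_attains_inf[OF \<open>compact S\<close> _ contN] by blast
  have "z0 \<noteq> (\<lambda>i. 0)" using z0(1) by (auto simp: S_def)
  then have pos: "N z0 > 0"
    using eq_0_iff[OF cvecS[OF z0(1)]] nonneg[OF cvecS[OF z0(1)]] by linarith
  have "cmod (z i) \<le> max 1 (1 / N z0) * N z" if z: "z \<in> cvec n" for z i
  proof -
    define t where "t = (\<Sum>i<n. cmod (z i))"
    have le: "cmod (z i) \<le> t"
    proof (cases "i < n")
      case True
      then show ?thesis unfolding t_def by (intro member_le_sum) auto
    next
      case False
      then show ?thesis using z by (auto simp: t_def cvec_def intro!: sum_nonneg)
    qed
    show ?thesis
    proof (cases "t = 0")
      case True
      have "0 \<le> max 1 (1 / N z0) * N z" using nonneg[OF z] by (intro mult_nonneg_nonneg) auto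
      then show ?thesis using True le by simp
    next
      case False
      then have "t > 0" unfolding t_def by (metis norm_ge_zero order_le_less sum_nonneg)
      define w where "w = (\<lambda>i. of_real (1 / t) * z i)"
      have ws: "(\<Sum>i<n. cmod (w i)) = 1"
        using \<open>t > 0\<close> unfolding w_def norm_mult sum_distrib_left[symmetric] t_def[symmetric] by (simp add: norm_divide)
      have "cmod (w i) \<le> 1" if "i < n" for i
        unfolding ws[symmetric] using that by (intro member_le_sum) auto
      moreover have "w i = 0" if "\<not> i < n" for i using that z by (auto simp: w_def cvec_def)
      ultimately have "w \<in> S" using ws by (auto simp: S_def B_def PiE_iff)
      then have "N z0 \<le> 1 / t * N z"
        using z0(2)[of w] scale[OF z, of "of_real (1/t)"] \<open>t > 0\<close> by (simp add: w_def norm_divide)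
      then have "t \<le> 1 / N z0 * N z" using \<open>t > 0\<close> pos by (simp add: field_simps)
      also have "\<dots> \<le> max 1 (1 / N z0) * N z" using nonneg[OF z] by (intro mult_right_mono) auto
      finally show ?thesis using le by simp
    qed
  qed
  then show ?thesis using that[of "max 1 (1 / N z0)"] by auto
qed

section \<open>Separated sets and nets\<close>

definition separated :: "real \<Rightarrow> (nat \<Rightarrow> complex) set \<Rightarrow> bool" where
  "separated \<eta> T \<longleftrightarrow> T \<subseteq> cvec n \<and> (\<forall>z\<in>T. \<forall>w\<in>T. z \<noteq> w \<longrightarrow> \<eta> \<le> N (\<lambda>i. z i - w i))"

text \<open>Any bound of the shape \<open>(A / \<eta>)\<^bsup>2n\<^esup>\<close> suffices here, however bad \<open>A\<close> is:
  it is removed by a tensor power argument below.\<close>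

lemma separated_card_crude:
  obtains A where "A > 0"
    "\<And>\<eta> T. separated \<eta> T \<Longrightarrow> (\<And>z. z \<in> T \<Longrightarrow> N z \<le> 2) \<Longrightarrow> 0 < \<eta> \<Longrightarrow> \<eta> \<le> 1 \<Longrightarrow>
       finite T \<and> real (card T) \<le> ((A / \<eta>)\<^sup>2) ^ n"
proof -
  obtain A where A: "A \<ge> 1" "\<And>z i. z \<in> cvec n \<Longrightarrow> cmod (z i) \<le> A * N z"
    by (rule coord_bound) blast
  \<comment> \<open>Two points in the same cell of a mesh of size \<open>\<eta> / G\<close> differ
    by at most \<open>2 * (\<eta> / G)\<close> in each complex coordinate, hence by less than
    \<open>\<eta>\<close> in norm, so separated points never share a cell. The summand 1 makes this
    strict.\<close>
  define G where "G = 2 * unit_sum + 1"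
  have G: "G \<ge> 1" using unit_sum_nonneg by (simp add: G_def)
  \<comment> \<open>There are \<open>2 * L + 1 \<le> 4 * A * G / \<eta> + 3\<close> mesh values per
    real coordinate, and \<open>\<eta> \<le> 1\<close> absorbs the 3.\<close>
  define A' where "A' = 4 * A * G + 3"
  have "finite T \<and> real (card T) \<le> ((A' / \<eta>)\<^sup>2) ^ n"
    if sep: "separated \<eta> T" and N2: "\<And>z. z \<in> T \<Longrightarrow> N z \<le> 2" and \<eta>: "0 < \<eta>" "\<eta> \<le> 1" for \<eta> T
  proof -
    define L where "L = \<lceil>2 * A * G / \<eta>\<rceil>"
    define g where "g = (\<lambda>z::nat \<Rightarrow> complex. \<lambda>i\<in>{..<n}. (\<lfloor>Re (z i) * G / \<eta>\<rfloor>, \<lfloor>Im (z i) * G / \<eta>\<rfloor>))"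
    define X where "X = PiE {..<n} (\<lambda>_. {-L..L} \<times> {-L..L})"
    have "0 \<le> 2 * A * G / \<eta>" using A G \<eta> by simp
    then have L: "0 \<le> L" unfolding L_def by linarith
    have fl: "\<lfloor>x * G / \<eta>\<rfloor> \<in> {-L..L}" if "\<bar>x\<bar> \<le> 2 * A" for x
    proof -
      have "\<bar>x * G / \<eta>\<bar> = \<bar>x\<bar> * (G / \<eta>)" using G \<eta> by (simp add: abs_mult)
      also have "\<dots> \<le> 2 * A * (G / \<eta>)" using that G \<eta> by (intro mult_right_mono) auto
      finally have "\<bar>x * G / \<eta>\<bar> \<le> 2 * A * G / \<eta>" by simp
      then have "x * G / \<eta> \<le> 2 * A * G / \<eta>" "- (2 * A * G / \<eta>) \<le> x * G / \<eta>"
        by (simp_all only: abs_le_iff minus_le_iff)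
      then show ?thesis unfolding L_def atLeastAtMost_iff by linarith
    qed
    have "g ` T \<subseteq> X"
    proof (safe)
      fix z assume "z \<in> T"
      then have z: "z \<in> cvec n" "N z \<le> 2" using sep N2 by (auto simp: separated_def)
      have "cmod (z i) \<le> 2 * A" for i
        using A(2)[OF z(1), of i] mult_left_mono[OF z(2), of A] A(1) by linarith
      then have "\<bar>Re (z i)\<bar> \<le> 2 * A" "\<bar>Im (z i)\<bar> \<le> 2 * A" for i
        using abs_Re_le_cmod[of "z i"] abs_Im_le_cmod[of "z i"] by (meson order_trans)+
      then show "g z \<in> X" unfolding g_def X_def using fl by (auto simp: PiE_iff)
    qed
    moreover have "inj_on g T"
    proof (rule inj_onI, rule ccontr)
      fix z w assume zw: "z \<in> T" "w \<in> T" "g z = g w" "z \<noteq> w"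
      then have c: "z \<in> cvec n" "w \<in> cvec n" and ge: "\<eta> \<le> N (\<lambda>i. z i - w i)"
        using sep by (auto simp: separated_def)
      have close: "\<bar>x - y\<bar> \<le> \<eta> / G" if "\<lfloor>x * G / \<eta>\<rfloor> = \<lfloor>y * G / \<eta>\<rfloor>" for x y
      proof -
        have "\<bar>x * G / \<eta> - y * G / \<eta>\<bar> \<le> 1" using that by linarith
        moreover have "x * G / \<eta> - y * G / \<eta> = (x - y) * (G / \<eta>)" by (simp add: diff_divide_distrib left_diff_distrib)
        ultimately have "\<bar>x - y\<bar> * (G / \<eta>) \<le> 1" using G \<eta> by (simp add: abs_mult)
        then show ?thesis using G \<eta> by (simp add: field_simps)
      qed
      have "cmod (z i - w i) \<le> 2 * (\<eta> / G)" if "i < n" for i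
      proof -
        have "g z i = g w i" using zw by simp
        then have "\<bar>Re (z i) - Re (w i)\<bar> \<le> \<eta> / G" "\<bar>Im (z i) - Im (w i)\<bar> \<le> \<eta> / G"
          using that by (auto simp: g_def intro!: close)
        then show ?thesis using cmod_le[of "z i - w i"] by simp
      qed
      then have "N (\<lambda>i. z i - w i) \<le> 2 * (\<eta> / G) * unit_sum"
        by (intro le_coord_bound cvec_diff c) auto
      also have "\<dots> < \<eta>"
        using G \<eta> unfolding G_def by (simp add: field_simps)
      finally show False using ge by simp
    qed
    moreover have fX: "finite X" unfolding X_def by (intro finite_PiE) auto
    ultimately have "finite T" and "card T \<le> card X"
      using finite_imageD finite_subset by (blast, metis card_image card_mono)
    have "card X = ((nat (2 * L + 1))\<^sup>2) ^ n"
      unfolding X_def by (simp add: card_PiE power2_eq_square)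
    then have "real (card X) = ((of_int (2 * L + 1))\<^sup>2) ^ n" using L by simp
    also have "\<dots> \<le> ((A' / \<eta>)\<^sup>2) ^ n"
    proof (intro power_mono)
      have "of_int L \<le> 2 * A * G / \<eta> + 1" unfolding L_def by linarith
      then have "of_int (2 * L + 1) \<le> 4 * A * G / \<eta> + 3" by simp
      also have "\<dots> \<le> 4 * A * G / \<eta> + 3 / \<eta>" using \<eta> by (simp add: field_simps)
      also have "\<dots> = A' / \<eta>" by (simp add: A'_def add_divide_distrib)
      finally show "real_of_int (2 * L + 1) \<le> A' / \<eta>" .
    qed (use L in auto)
    finally show ?thesis using \<open>finite T\<close> \<open>card T \<le> card X\<close> by (simp add: le_trans)
  qed
  moreover have "A' > 0" using A G unfolding A'_def by (smt (verit) mult_nonneg_nonneg)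
  ultimately show ?thesis using that by blast
qed

text \<open>The separated set is \<open>{t + (\<delta>/4) x}\<close> with \<open>t \<in> T\<close> and \<open>x\<close> from the previous step.
  Letting \<open>J \<rightarrow> \<infinity>\<close> in the crude bound then gives \<open>card T \<le> (4 / \<delta>)\<^bsup>2n\<^esup>\<close>, without
  any volume comparison.\<close>

lemma separated_tensor:
  assumes sep: "separated \<delta> T" and fin: "finite T" and ball: "\<And>z. z \<in> T \<Longrightarrow> N z \<le> 1"
    and \<delta>: "0 < \<delta>" "\<delta> \<le> 1"
  shows "\<exists>U. separated ((\<delta>/4) ^ J) U \<and> finite U \<and> card U = card T ^ J \<and> (\<forall>z\<in>U. N z \<le> 4/3)"
proof (induction J)
  case 0
  show ?case
    by (intro exI[of _ "{\<lambda>i. 0}"]) (auto simp: separated_def cvec_0)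
next
  case (Suc J)
  then obtain U where U: "separated ((\<delta>/4) ^ J) U" "finite U" "card U = card T ^ J" "\<And>z. z \<in> U \<Longrightarrow> N z \<le> 4/3"
    by blast
  define h where "h = (\<lambda>(t::nat\<Rightarrow>complex, x::nat\<Rightarrow>complex). (\<lambda>i. t i + of_real (\<delta>/4) * x i))"
  have sub: "T \<subseteq> cvec n" "U \<subseteq> cvec n" using sep U by (auto simp: separated_def)
  have h_in: "h (t, x) \<in> cvec n" if "t \<in> T" "x \<in> U" for t x
    unfolding h_def prod.case using that sub by (intro cvec_add cvec_scale) auto
  have sc: "N (\<lambda>i. of_real (\<delta>/4) * x i) = \<delta>/4 * N x" if "x \<in> cvec n" for x
    using scale[OF that, of "of_real (\<delta>/4)"] \<delta> by (simp add: norm_divide)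
  have key: "(\<delta>/4) ^ Suc J \<le> N (\<lambda>i. h (t, x) i - h (t', x') i)"
    if tx: "t \<in> T" "x \<in> U" "t' \<in> T" "x' \<in> U" "(t, x) \<noteq> (t', x')" for t x t' x'
  proof -
    have c: "t \<in> cvec n" "x \<in> cvec n" "t' \<in> cvec n" "x' \<in> cvec n" using tx sub by auto
    have dx: "(\<lambda>i. x i - x' i) \<in> cvec n" and dt: "(\<lambda>i. t i - t' i) \<in> cvec n"
      using c by (auto intro: cvec_diff)
    have eq: "(\<lambda>i. h (t, x) i - h (t', x') i) = (\<lambda>i. (t i - t' i) + of_real (\<delta>/4) * (x i - x' i))"
      by (simp add: h_def fun_eq_iff) (simp add: algebra_simps)
    show ?thesis
    proof (cases "t = t'")
      case True
      then have "x \<noteq> x'" using tx by auto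
      then have "(\<delta>/4) ^ J \<le> N (\<lambda>i. x i - x' i)" using U(1) tx by (auto simp: separated_def)
      then have "\<delta>/4 * (\<delta>/4) ^ J \<le> \<delta>/4 * N (\<lambda>i. x i - x' i)" using \<delta> by (intro mult_left_mono) auto
      then show ?thesis unfolding eq using True sc[OF dx] by simp
    next
      case False
      then have d: "\<delta> \<le> N (\<lambda>i. t i - t' i)" using sep tx by (auto simp: separated_def)
      \<comment> \<open>Points of \<open>U\<close> are at most \<open>2 * (4/3)\<close> apart;
        scaled by \<open>\<delta>/4\<close> this costs \<open>2 * \<delta> / 3\<close> of the
        distance \<delta>, and the remaining \<open>\<delta>/3\<close> exceeds
        \<open>\<delta>/4\<close>.\<close>
      have "N (\<lambda>i. x i - x' i) \<le> 8/3"
        using triangle_diff[OF c(2) c(4)] U(4)[OF tx(2)] U(4)[OF tx(4)] by simp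
      then have "\<delta>/4 * N (\<lambda>i. x i - x' i) \<le> \<delta>/4 * (8/3)" using \<delta> by (intro mult_left_mono) auto
      moreover have "N (\<lambda>i. t i - t' i) \<le> N (\<lambda>i. (t i - t' i) + of_real (\<delta>/4) * (x i - x' i)) + \<delta>/4 * N (\<lambda>i. x i - x' i)"
        using triangle_diff[OF cvec_add[OF dt cvec_scale[OF dx, of "of_real (\<delta>/4)"]] cvec_scale[OF dx, of "of_real (\<delta>/4)"]]
          sc[OF dx] by simp
      ultimately have "\<delta>/3 \<le> N (\<lambda>i. h (t, x) i - h (t', x') i)" using d unfolding eq by simp
      moreover have "(\<delta>/4) ^ Suc J \<le> \<delta>/4"
        using \<delta> power_decreasing[of 1 "Suc J" "\<delta>/4"] by simp
      ultimately show ?thesis using \<delta> by linarith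
    qed
  qed
  have inj: "inj_on h (T \<times> U)"
  proof (rule inj_onI, rule ccontr)
    fix a b assume ab: "a \<in> T \<times> U" "b \<in> T \<times> U" "h a = h b" "a \<noteq> b"
    obtain t x t' x' where [simp]: "a = (t, x)" "b = (t', x')" by (cases a, cases b)
    have "(\<delta>/4) ^ Suc J \<le> N (\<lambda>i. h (t, x) i - h (t', x') i)" using ab by (intro key) auto
    also have "\<dots> = 0" using ab by simp
    finally have "(\<delta>/4) ^ Suc J \<le> 0" .
    moreover have "0 < (\<delta>/4) ^ Suc J" by (rule zero_less_power) (use \<delta> in simp)
    ultimately show False by linarith
  qed
  show ?case
  proof (intro exI[of _ "h ` (T \<times> U)"] conjI)
    show "separated ((\<delta>/4) ^ Suc J) (h ` (T \<times> U))"
      unfolding separated_def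
    proof (intro conjI ballI impI)
      show "h ` (T \<times> U) \<subseteq> cvec n" using h_in by auto
      fix a b assume ab: "a \<in> h ` (T \<times> U)" "b \<in> h ` (T \<times> U)" "a \<noteq> b"
      then obtain t x t' x' where "a = h (t, x)" "b = h (t', x')" "t \<in> T" "x \<in> U" "t' \<in> T" "x' \<in> U"
        by blast
      moreover from this have "(t, x) \<noteq> (t', x')" using ab(3) by blast
      ultimately show "(\<delta>/4) ^ Suc J \<le> N (\<lambda>i. a i - b i)" using key[of t x t' x'] by simp
    qed
    show "finite (h ` (T \<times> U))" using fin U by auto
    show "card (h ` (T \<times> U)) = card T ^ Suc J"
      using card_image[OF inj] U by (simp add: card_cartesian_product)
    show "\<forall>z\<in>h ` (T \<times> U). N z \<le> 4/3"
    proof clarify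
      fix t x assume tx: "t \<in> T" "x \<in> U"
      then have c: "t \<in> cvec n" "x \<in> cvec n" using sub by auto
      have "N (h (t, x)) \<le> N t + \<delta>/4 * N x"
        using triangle[OF c(1) cvec_scale[OF c(2)], of "of_real (\<delta>/4)"] sc[OF c(2)] by (simp add: h_def)
      \<comment> \<open>The radius 4/3 reproduces itself, since 1 + (1/4)(4/3) = 4/3, and it stays
        below the radius 2 of the crude bound.\<close>
      moreover have "\<delta>/4 * N x \<le> 1/4 * (4/3)" using \<delta> U(4)[OF tx(2)] nonneg[OF c(2)] by (intro mult_mono) auto
      ultimately show "N (h (t, x)) \<le> 4/3" using ball[OF tx(1)] by simp
    qed
  qed
qed

lemma separated_card:
  assumes sep: "separated \<delta> T" and ball: "\<And>z. z \<in> T \<Longrightarrow> N z \<le> 1" and \<delta>: "0 < \<delta>" "\<delta> \<le> 1"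
  shows "finite T \<and> real (card T) \<le> ((4 / \<delta>)\<^sup>2) ^ n"
proof -
  obtain A where A: "A > 0" "\<And>\<eta> T. separated \<eta> T \<Longrightarrow> (\<And>z. z \<in> T \<Longrightarrow> N z \<le> 2) \<Longrightarrow> 0 < \<eta> \<Longrightarrow> \<eta> \<le> 1 \<Longrightarrow>
       finite T \<and> real (card T) \<le> ((A / \<eta>)\<^sup>2) ^ n"
    by (rule separated_card_crude) blast
  have fin: "finite T" using A(2)[OF sep _ \<delta>] ball by force
  define K where "K = real (card T)"
  \<comment> \<open>The normalised count: its powers stay below \<open>(A\<^sup>2) ^ n\<close> for
    every exponent \<open>J\<close>, which forces \<open>x \<le> 1\<close>, and this is the claim
    without \<open>A\<close>.\<close>
  define x where "x = K * ((\<delta> / 4)\<^sup>2) ^ n"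
  have bound: "x ^ J \<le> (A\<^sup>2) ^ n" for J
  proof -
    obtain U where U: "separated ((\<delta>/4) ^ J) U" "finite U" "card U = card T ^ J" "\<And>z. z \<in> U \<Longrightarrow> N z \<le> 4/3"
      using separated_tensor[OF sep fin ball \<delta>] by blast
    have "real (card U) \<le> ((A / (\<delta>/4) ^ J)\<^sup>2) ^ n"
    proof (rule A(2)[OF U(1), THEN conjunct2])
      show "N z \<le> 2" if "z \<in> U" for z using U(4)[OF that] by simp
    qed (use \<delta> in \<open>auto intro!: power_le_one\<close>)
    then have "K ^ J \<le> ((A / (\<delta>/4) ^ J)\<^sup>2) ^ n" using U by (simp add: K_def)
    then have "K ^ J * (((\<delta>/4) ^ J)\<^sup>2) ^ n \<le> ((A / (\<delta>/4) ^ J)\<^sup>2) ^ n * (((\<delta>/4) ^ J)\<^sup>2) ^ n"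
      by (intro mult_right_mono) auto
    also have "\<dots> = (A\<^sup>2) ^ n"
      using \<delta> by (simp add: power_mult_distrib[symmetric])
    also have "K ^ J * (((\<delta>/4) ^ J)\<^sup>2) ^ n = x ^ J"
      unfolding x_def power_mult_distrib by (simp add: power_mult[symmetric] mult_ac)
    finally show ?thesis .
  qed
  have "x \<le> 1"
  proof (rule ccontr)
    assume "\<not> x \<le> 1"
    then obtain J where "(A\<^sup>2) ^ n < x ^ J" using real_arch_pow[of x] by auto
    with bound[of J] show False by simp
  qed
  define y where "y = ((4 / \<delta>)\<^sup>2) ^ n"
  have "((\<delta> / 4)\<^sup>2) ^ n * y = (((\<delta> / 4) * (4 / \<delta>))\<^sup>2) ^ n"
    unfolding y_def by (simp only: power_mult_distrib)
  also have "(\<delta> / 4) * (4 / \<delta>) = 1" using \<delta> by simp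
  finally have "((\<delta> / 4)\<^sup>2) ^ n * y = 1" by simp
  then have "K = x * y" by (simp add: x_def mult.assoc)
  also have "\<dots> \<le> 1 * y" by (rule mult_right_mono[OF \<open>x \<le> 1\<close>]) (simp add: y_def)
  finally have "K \<le> y" by simp
  then show ?thesis using fin unfolding K_def y_def by blast
qed

text \<open>A separated subset of the ball with the largest number of points is a net, because a
  point farther than \<delta> from all of it could be added. A largest one exists since
  \<open>separated_card\<close> bounds all the cardinalities.\<close>

lemma ball_net:
  assumes \<delta>: "0 < \<delta>" "\<delta> \<le> 1"
  obtains F where "finite F" "F \<noteq> {}" "F \<subseteq> unit_ball n N" "real (card F) \<le> ((4 / \<delta>)\<^sup>2) ^ n"
    "\<And>z. z \<in> unit_ball n N \<Longrightarrow> \<exists>w\<in>F. N (\<lambda>i. z i - w i) \<le> \<delta>"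
proof -
  define \<F> where "\<F> = {T. separated \<delta> T \<and> T \<subseteq> unit_ball n N}"
  have bd: "finite T \<and> real (card T) \<le> ((4 / \<delta>)\<^sup>2) ^ n" if "T \<in> \<F>" for T
  proof (rule separated_card[OF _ _ \<delta>])
    show "separated \<delta> T" using that by (simp add: \<F>_def)
    show "N z \<le> 1" if "z \<in> T" for z
      using that \<open>T \<in> \<F>\<close> by (auto simp: \<F>_def unit_ball_def)
  qed
  have "card T \<le> nat \<lfloor>((4 / \<delta>)\<^sup>2) ^ n\<rfloor>" if "T \<in> \<F>" for T
    using bd[OF that] le_nat_floor by blast
  moreover have z0: "{\<lambda>i. 0} \<in> \<F>" by (auto simp: \<F>_def separated_def unit_ball_def cvec_0)
  ultimately obtain F where F: "F \<in> \<F>" "\<And>T. T \<in> \<F> \<Longrightarrow> card T \<le> card F"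
    using ex_has_greatest_nat[of "\<lambda>T. T \<in> \<F>" "{\<lambda>i. 0}" card "Suc (nat \<lfloor>((4 / \<delta>)\<^sup>2) ^ n\<rfloor>)"]
    by (auto simp: less_Suc_eq_le)
  show ?thesis
  proof
    show "finite F" "real (card F) \<le> ((4 / \<delta>)\<^sup>2) ^ n" using bd[OF F(1)] by auto
    show "F \<subseteq> unit_ball n N" using F(1) by (simp add: \<F>_def)
    show "F \<noteq> {}" using F(2)[OF z0] by auto
    fix z assume z: "z \<in> unit_ball n N"
    show "\<exists>w\<in>F. N (\<lambda>i. z i - w i) \<le> \<delta>"
    proof (rule ccontr)
      assume "\<not> ?thesis"
      then have far: "\<And>w. w \<in> F \<Longrightarrow> \<delta> < N (\<lambda>i. z i - w i)" by force
      have "z \<notin> F" using far[of z] \<delta> by auto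
      have zc: "z \<in> cvec n" and Fc: "F \<subseteq> cvec n" using z F(1) by (auto simp: unit_ball_def \<F>_def)
      have "insert z F \<in> \<F>"
        unfolding \<F>_def separated_def
      proof (safe)
        fix w assume w: "w \<in> F"
        show "\<delta> \<le> N (\<lambda>i. z i - w i)" using far[OF w] by simp
        show "\<delta> \<le> N (\<lambda>i. w i - z i)" using far[OF w] diff_commute[OF zc, of w] w Fc by auto
      qed (use z zc Fc F(1) in \<open>auto simp: \<F>_def separated_def\<close>)
      from F(2)[OF this] show False using \<open>z \<notin> F\<close> \<open>finite F\<close> by simp
    qed
  qed
qed

end

section \<open>Polynomials on the unit ball\<close>

lemma multi_index_sum: "sum_list \<alpha> = (\<Sum>i<length \<alpha>. \<alpha> ! i)"
  by (simp add: sum_list_sum_nth atLeast0LessThan)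

lemma finite_multi_indices_le: "finite {\<alpha>::nat list. length \<alpha> = n \<and> sum_list \<alpha> \<le> m}"
proof (rule finite_subset)
  show "{\<alpha>. length \<alpha> = n \<and> sum_list \<alpha> \<le> m} \<subseteq> {\<alpha>. set \<alpha> \<subseteq> {..m} \<and> length \<alpha> = n}"
    using member_le_sum_list by (fastforce intro: order_trans)
qed (simp add: finite_lists_length_eq)

lemma monomial_scale: "monomial \<alpha> (\<lambda>i. a * z i) = a ^ sum_list \<alpha> * monomial \<alpha> z"
  by (simp add: monomial_def power_mult_distrib prod.distrib power_sum multi_index_sum)

definition poly_fun :: "nat \<Rightarrow> nat \<Rightarrow> (nat list \<Rightarrow> complex) \<Rightarrow> (nat \<Rightarrow> complex) \<Rightarrow> complex" where
  "poly_fun n m b z = (\<Sum>\<alpha>\<in>{\<alpha>. length \<alpha> = n \<and> sum_list \<alpha> \<le> m}. b \<alpha> * monomial \<alpha> z)"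

lemma poly_fun_line_holomorphic: "(\<lambda>\<zeta>. poly_fun n m b (\<lambda>i. w i + \<zeta> * h i)) holomorphic_on S"
  unfolding poly_fun_def monomial_def by (intro holomorphic_intros)

section \<open>Growth, oscillation and discretisation of polynomials on the ball\<close>

context cnorm
begin

lemma zero_in_ball: "(\<lambda>i. 0) \<in> unit_ball n N"
  by (simp add: unit_ball_def cvec_0)

lemma ball_scale: "z \<in> unit_ball n N \<Longrightarrow> cmod a \<le> 1 \<Longrightarrow> (\<lambda>i. a * z i) \<in> unit_ball n N"
  using scale[of z a] nonneg[of z] mult_mono[of "cmod a" 1 "N z" 1]
  by (auto simp: unit_ball_def cvec_scale)

lemma ball_coord_bound:
  obtains A where "A \<ge> 1" "\<And>z i. z \<in> unit_ball n N \<Longrightarrow> cmod (z i) \<le> A"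
proof -
  obtain A where A: "A \<ge> 1" "\<And>z i. z \<in> cvec n \<Longrightarrow> cmod (z i) \<le> A * N z"
    by (rule coord_bound) blast
  have "cmod (z i) \<le> A" if "z \<in> unit_ball n N" for z i
  proof -
    have "cmod (z i) \<le> A * N z" "N z \<le> 1" using A(2)[of z i] that by (auto simp: unit_ball_def)
    with mult_left_mono[of "N z" 1 A] A(1) show ?thesis by linarith
  qed
  with A(1) show ?thesis using that by blast
qed

text \<open>Used for finiteness only: it makes the real \<open>SUP\<close> over the ball a genuine
  least upper bound, which the absorption argument in \<open>poly_fun_net\<close> needs.\<close>

lemma poly_fun_bounded:
  obtains A where "\<And>z. z \<in> unit_ball n N \<Longrightarrow> cmod (poly_fun n m b z) \<le> A"
proof -
  obtain A where A: "A \<ge> 1" "\<And>z i. z \<in> unit_ball n N \<Longrightarrow> cmod (z i) \<le> A"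
    by (rule ball_coord_bound) blast
  have "cmod (poly_fun n m b z) \<le>
      (\<Sum>\<alpha>\<in>{\<alpha>. length \<alpha> = n \<and> sum_list \<alpha> \<le> m}. cmod (b \<alpha>) * (\<Prod>i<length \<alpha>. A ^ (\<alpha> ! i)))"
    if "z \<in> unit_ball n N" for z
    unfolding poly_fun_def monomial_def using A that
    by (intro sum_norm_le) (auto simp: norm_mult prod_norm[symmetric] norm_power
        intro!: mult_left_mono prod_mono power_mono)
  with that show ?thesis by blast
qed

text \<open>The maximum principle for the reversed polynomial \<open>\<zeta>\<^sup>m f (z / \<zeta>)\<close>.\<close>

lemma poly_fun_growth:
  assumes A: "\<And>z. z \<in> unit_ball n N \<Longrightarrow> cmod (poly_fun n m b z) \<le> A"
    and z: "z \<in> unit_ball n N" and \<xi>: "1 \<le> cmod \<xi>"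
  shows "cmod (poly_fun n m b (\<lambda>i. \<xi> * z i)) \<le> A * cmod \<xi> ^ m"
proof -
  let ?I = "{\<alpha>. length \<alpha> = n \<and> sum_list \<alpha> \<le> m}"
  \<comment> \<open>Since \<open>sum_list \<alpha> \<le> m\<close>, the natural-number subtraction
    is exact, and \<open>g\<close> is a polynomial, holomorphic also at 0. It is evaluated at
    \<open>1 / \<xi>\<close>, a point of the closed unit disc.\<close>
  define g where "g = (\<lambda>\<zeta>. \<Sum>\<alpha>\<in>?I. b \<alpha> * \<zeta> ^ (m - sum_list \<alpha>) * monomial \<alpha> z)"
  have g: "poly_fun n m b (\<lambda>i. \<zeta> * z i) = \<zeta> ^ m * g (1 / \<zeta>)" if "\<zeta> \<noteq> 0" for \<zeta>
    unfolding poly_fun_def g_def sum_distrib_left monomial_scale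
  proof (intro sum.cong refl)
    fix \<alpha> assume "\<alpha> \<in> ?I"
    then have "\<zeta> ^ m = \<zeta> ^ (m - sum_list \<alpha>) * \<zeta> ^ sum_list \<alpha>" by (simp flip: power_add)
    then show "b \<alpha> * (\<zeta> ^ sum_list \<alpha> * monomial \<alpha> z) =
        \<zeta> ^ m * (b \<alpha> * (1 / \<zeta>) ^ (m - sum_list \<alpha>) * monomial \<alpha> z)"
      using that by (simp add: power_one_over)
  qed
  have holo: "g holomorphic_on S" for S unfolding g_def by (intro holomorphic_intros)
  have "cmod (g (1 / \<xi>)) \<le> A"
  proof (rule maximum_modulus_frontier[where S = "cball 0 1" and f = g])
    show "continuous_on (closure (cball 0 1)) g" by (intro holomorphic_on_imp_continuous_on holo)
    show "1 / \<xi> \<in> cball 0 1" using \<xi> by (simp add: norm_divide divide_le_eq)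
    fix \<zeta> :: complex assume "\<zeta> \<in> frontier (cball 0 1)"
    then have \<zeta>: "cmod \<zeta> = 1" by simp
    then have [simp]: "\<zeta> \<noteq> 0" by auto
    have "cmod (poly_fun n m b (\<lambda>i. (1 / \<zeta>) * z i)) \<le> A"
      by (intro A ball_scale[OF z]) (simp add: norm_divide \<zeta>)
    moreover have "poly_fun n m b (\<lambda>i. (1 / \<zeta>) * z i) = (1 / \<zeta>) ^ m * g \<zeta>"
      using g[of "1 / \<zeta>"] by simp
    ultimately show "cmod (g \<zeta>) \<le> A" by (simp add: norm_mult norm_power norm_divide \<zeta>)
  qed (use holo in auto)
  then have "cmod \<xi> ^ m * cmod (g (1 / \<xi>)) \<le> cmod \<xi> ^ m * A" by (intro mult_left_mono) auto
  moreover have "\<xi> \<noteq> 0" using \<xi> by auto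
  ultimately show ?thesis using g[of \<xi>] by (simp add: norm_mult norm_power mult.commute)
qed

text \<open>At points of norm at most \<open>1 + 1/m\<close> the polynomial is at most
  \<open>3 * A\<close>, because \<open>(1 + 1/m) ^ m \<le> exp 1 \<le> 3\<close>. On the complex
  line through \<open>w\<close> and \<open>z\<close>, Cauchy's inequality on circles of radius
  \<open>1 / (2 * m)\<close> then bounds the derivative by \<open>6 * m * A\<close>, and over a
  parameter distance of \<open>1 / (12 * m)\<close> this amounts to \<open>A / 2\<close>; hence the
  12.\<close>

lemma poly_fun_oscillation:
  assumes A: "\<And>z. z \<in> unit_ball n N \<Longrightarrow> cmod (poly_fun n m b z) \<le> A"
    and m: "m > 0"
    and z: "z \<in> unit_ball n N" and w: "w \<in> unit_ball n N"
    and close: "N (\<lambda>i. z i - w i) \<le> 1 / (12 * real m)"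
  shows "cmod (poly_fun n m b z - poly_fun n m b w) \<le> A / 2"
proof -
  have A0: "0 \<le> A" using A[OF zero_in_ball] norm_ge_zero order_trans by blast
  \<comment> \<open>Rescaled so that \<open>N h \<le> 1\<close> and \<open>z\<close> is the point
    with parameter \<open>1 / (12 * m)\<close>.\<close>
  define h where "h = (\<lambda>i. of_real (12 * real m) * (z i - w i))"
  define \<phi> where "\<phi> = (\<lambda>\<zeta>. poly_fun n m b (\<lambda>i. w i + \<zeta> * h i))"
  have wc: "w \<in> cvec n" "N w \<le> 1" and zc: "z \<in> cvec n" using w z by (auto simp: unit_ball_def)
  have dc: "(\<lambda>i. z i - w i) \<in> cvec n" by (rule cvec_diff[OF zc wc(1)])
  have hc: "h \<in> cvec n" unfolding h_def by (rule cvec_scale[OF dc])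
  have "N h = 12 * real m * N (\<lambda>i. z i - w i)"
    unfolding h_def scale[OF dc] by simp
  also have "\<dots> \<le> 1" using close m by (simp add: field_simps)
  finally have h1: "N h \<le> 1" .
  have holo: "\<phi> holomorphic_on S" for S unfolding \<phi>_def by (rule poly_fun_line_holomorphic)
  have bound: "cmod (\<phi> \<zeta>) \<le> 3 * A" if \<zeta>: "cmod \<zeta> \<le> 1 / real m" for \<zeta>
  proof -
    define q where "q = 1 + 1 / real m"
    have q: "q \<ge> 1" by (simp add: q_def)
    define v where "v = (\<lambda>i. of_real (1 / q) * (w i + \<zeta> * h i))"
    have uc: "(\<lambda>i. w i + \<zeta> * h i) \<in> cvec n" by (intro cvec_add wc cvec_scale hc)
    have "N (\<lambda>i. w i + \<zeta> * h i) \<le> N w + cmod \<zeta> * N h"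
      using triangle[OF wc(1) cvec_scale[OF hc]] scale[OF hc] by simp
    also have "cmod \<zeta> * N h \<le> 1 / real m * 1" using \<zeta> h1 nonneg[OF hc] by (intro mult_mono) auto
    also have "N w + 1 / real m * 1 \<le> q" using wc by (simp add: q_def)
    finally have "N (\<lambda>i. w i + \<zeta> * h i) \<le> q" by simp
    then have "v \<in> unit_ball n N"
      unfolding unit_ball_def v_def mem_Collect_eq scale[OF uc]
      using q by (intro conjI cvec_scale uc) (simp add: norm_divide)
    from poly_fun_growth[OF A this, of "of_real q"] q
    have "cmod (poly_fun n m b (\<lambda>i. of_real q * v i)) \<le> A * q ^ m" by simp
    also have "(\<lambda>i. of_real q * v i) = (\<lambda>i. w i + \<zeta> * h i)" using q by (auto simp: v_def)
    also have "A * q ^ m \<le> A * 3"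
    proof (intro mult_left_mono A0)
      have "q \<le> exp (1 / real m)" unfolding q_def by (rule exp_ge_add_one_self)
      then have "q ^ m \<le> exp (1 / real m) ^ m" using q by (intro power_mono) auto
      also have "\<dots> = exp 1" using m by (simp flip: exp_of_nat_mult)
      finally show "q ^ m \<le> 3" using exp_le by linarith
    qed
    finally show ?thesis by (simp add: \<phi>_def)
  qed
  \<comment> \<open>Half the radius on which \<open>\<phi>\<close> is bounded, so that a circle of
    the same radius around a point of \<open>S\<close> stays in the larger disc.\<close>
  define S where "S = cball (0::complex) (1 / (2 * real m))"
  have d: "cmod (deriv \<phi> \<zeta>) \<le> 6 * real m * A" if "\<zeta> \<in> S" for \<zeta>
  proof -
    have "cmod ((deriv ^^ 1) \<phi> \<zeta>) \<le> fact 1 * (3 * A) / (1 / (2 * real m)) ^ 1"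
    proof (rule Cauchy_inequality)
      fix x assume x: "cmod (\<zeta> - x) = 1 / (2 * real m)"
      have "cmod x \<le> cmod \<zeta> + cmod (\<zeta> - x)"
        using norm_triangle_sub[of x \<zeta>] norm_minus_commute[of x \<zeta>] by simp
      also have "\<dots> \<le> 1 / (2 * real m) + 1 / (2 * real m)" using that x by (simp add: S_def)
      also have "\<dots> = 1 / real m" by simp
      finally show "cmod (\<phi> x) \<le> 3 * A" by (rule bound)
    next
      show "\<phi> holomorphic_on ball \<zeta> (1 / (2 * real m))" by (rule holo)
      show "continuous_on (cball \<zeta> (1 / (2 * real m))) \<phi>" by (rule holomorphic_on_imp_continuous_on[OF holo])
      show "0 < 1 / (2 * real m)" using m by simp
    qed
    then show ?thesis by (simp add: mult_ac)
  qed
  have "cmod (\<phi> (of_real (1 / (12 * real m))) - \<phi> 0) \<le> 6 * real m * A * cmod (of_real (1 / (12 * real m)) - 0)"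
  proof (rule field_differentiable_bound[where S = S and f' = "deriv \<phi>"])
    show "(\<phi> has_field_derivative deriv \<phi> \<zeta>) (at \<zeta> within S)" for \<zeta>
      using holomorphic_derivI[OF holo[of UNIV], of \<zeta> S] by simp
    show "complex_of_real (1 / (12 * real m)) \<in> S"
      using m by (simp add: S_def norm_divide field_simps)
  qed (use d in \<open>auto simp: S_def\<close>)
  also have "\<dots> = A / 2" using m by (simp add: norm_divide)
  finally show ?thesis using m by (simp add: \<phi>_def h_def)
qed

text \<open>If \<open>A\<close> is the supremum over the ball and \<open>Y\<close> the maximum over
  the net, oscillation gives \<open>A \<le> Y + A / 2\<close>, and \<open>A\<close>, being finite,
  can be absorbed. The number 48 is the 4 of \<open>ball_net\<close> times the 12 of the mesh.
  \<open>F\<close> comes before \<open>b\<close>, so that it does not vary with the outcome.\<close>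

lemma poly_fun_net:
  assumes m: "m > 0"
  obtains F where "finite F" "F \<noteq> {}" "F \<subseteq> unit_ball n N" "real (card F) \<le> ((48 * real m)\<^sup>2) ^ n"
    "\<And>b z. z \<in> unit_ball n N \<Longrightarrow> cmod (poly_fun n m b z) \<le> 2 * (MAX w\<in>F. cmod (poly_fun n m b w))"
proof -
  have "0 < 1 / (12 * real m)" "1 / (12 * real m) \<le> 1" using m by auto
  from ball_net[OF this] obtain F where F: "finite F" "F \<noteq> {}" "F \<subseteq> unit_ball n N"
    "real (card F) \<le> ((4 / (1 / (12 * real m)))\<^sup>2) ^ n"
    and net: "\<And>z. z \<in> unit_ball n N \<Longrightarrow> \<exists>w\<in>F. N (\<lambda>i. z i - w i) \<le> 1 / (12 * real m)"
    by blast
  have "cmod (poly_fun n m b z) \<le> 2 * (MAX w\<in>F. cmod (poly_fun n m b w))"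
    if z: "z \<in> unit_ball n N" for b z
  proof -
    define A where "A = (SUP z\<in>unit_ball n N. cmod (poly_fun n m b z))"
    define Y where "Y = (MAX w\<in>F. cmod (poly_fun n m b w))"
    obtain A' where "\<And>z. z \<in> unit_ball n N \<Longrightarrow> cmod (poly_fun n m b z) \<le> A'"
      using poly_fun_bounded by blast
    then have bdd: "bdd_above ((\<lambda>z. cmod (poly_fun n m b z)) ` unit_ball n N)" by (auto intro!: bdd_aboveI[of _ A'])
    have A: "cmod (poly_fun n m b z) \<le> A" if "z \<in> unit_ball n N" for z
      unfolding A_def using that bdd by (rule cSUP_upper)
    have "A \<le> Y + A / 2"
      unfolding A_def
    proof (rule cSUP_least, fold A_def)
      show "unit_ball n N \<noteq> {}" using zero_in_ball by blast
      fix z assume z: "z \<in> unit_ball n N"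
      obtain w where w: "w \<in> F" "N (\<lambda>i. z i - w i) \<le> 1 / (12 * real m)" using net[OF z] by blast
      have "cmod (poly_fun n m b w) \<le> Y" unfolding Y_def using F(1) w(1) by (intro Max_ge) auto
      moreover have "cmod (poly_fun n m b z - poly_fun n m b w) \<le> A / 2"
        using w F(3) by (intro poly_fun_oscillation[OF A m z]) auto
      moreover have "cmod (poly_fun n m b z) \<le> cmod (poly_fun n m b w) + cmod (poly_fun n m b z - poly_fun n m b w)"
        by (metis add.commute diff_add_cancel norm_triangle_ineq)
      ultimately show "cmod (poly_fun n m b z) \<le> Y + A / 2" by linarith
    qed
    then show ?thesis using A[OF z] unfolding Y_def by linarith
  qed
  moreover have "real (card F) \<le> ((48 * real m)\<^sup>2) ^ n" using F(4) by simp
  ultimately show ?thesis using that F(1-3) by blast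
qed

end

section \<open>Tails and Orlicz norms of random sums\<close>

text \<open>An infimum strictly below \<open>s\<close> leaves some admissible \<open>t < s\<close>,
  so it need not be known to be attained. Real variables satisfy the complex condition as well: for
  them only \<open>Re z\<close> enters, and \<open>\<bar>Re z\<bar> \<le> cmod z\<close>. Later
  steps therefore treat both kinds alike.\<close>

lemma subgaussian_mgf:
  assumes f: "subgaussian P f" and s: "sg P f < s"
  shows "(\<integral>\<^sup>+ \<omega>. ennreal (exp (Re (z * f \<omega>))) \<partial>P) \<le> ennreal (exp (s\<^sup>2 * (cmod z)\<^sup>2 / 2))"
proof -
  obtain t where t: "t \<in> subgaussian_bounds P f" "t < s"
    using f s cInf_lessD[of "subgaussian_bounds P f" s] by (auto simp: sg_def subgaussian_def)
  then have t0: "0 \<le> t" by (auto simp: subgaussian_bounds_def split: if_splits)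
  have ts: "t\<^sup>2 \<le> s\<^sup>2" using t t0 by (intro power_mono) auto
  show ?thesis
  proof (cases "f ` space P \<subseteq> \<real>")
    case True
    then have re: "Re (z * f \<omega>) = Re z * Re (f \<omega>)" if "\<omega> \<in> space P" for \<omega>
      using that by (auto simp: complex_is_Real_iff image_subset_iff)
    have "(\<integral>\<^sup>+ \<omega>. ennreal (exp (Re (z * f \<omega>))) \<partial>P) = (\<integral>\<^sup>+ \<omega>. ennreal (exp (Re z * Re (f \<omega>))) \<partial>P)"
      by (intro nn_integral_cong) (simp only: re)
    also have "\<dots> \<le> ennreal (exp (t\<^sup>2 * (Re z)\<^sup>2 / 2))"
      using t(1) True by (simp add: subgaussian_bounds_def)
    also have "(Re z)\<^sup>2 \<le> (cmod z)\<^sup>2" by (simp add: cmod_power2)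
    then have "ennreal (exp (t\<^sup>2 * (Re z)\<^sup>2 / 2)) \<le> ennreal (exp (s\<^sup>2 * (cmod z)\<^sup>2 / 2))"
      using mult_mono[OF ts, of "(Re z)\<^sup>2" "(cmod z)\<^sup>2"] by (intro ennreal_leI) simp
    finally show ?thesis .
  next
    case False
    then have "(\<integral>\<^sup>+ \<omega>. ennreal (exp (Re (z * f \<omega>))) \<partial>P) \<le> ennreal (exp (t\<^sup>2 * (cmod z)\<^sup>2 / 2))"
      using t(1) by (simp add: subgaussian_bounds_def)
    also have "\<dots> \<le> ennreal (exp (s\<^sup>2 * (cmod z)\<^sup>2 / 2))"
      using mult_right_mono[OF ts, of "(cmod z)\<^sup>2"] by (intro ennreal_leI) simp
    finally show ?thesis .
  qed
qed

section \<open>Exponential moments, tails and maxima\<close>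

context prob_space
begin

lemma ennreal_prod_mono:
  fixes f g :: "'b \<Rightarrow> ennreal"
  shows "(\<And>i. i \<in> J \<Longrightarrow> f i \<le> g i) \<Longrightarrow> prod f J \<le> prod g J"
  by (induction J rule: infinite_finite_induct) (auto intro!: mult_mono)

text \<open>Independence makes the expectation of the product of exponentials factorise. A complex
  \<open>z\<close> is allowed so that the sum can be tested in several directions.\<close>

lemma mgf_sum:
  fixes X :: "'i \<Rightarrow> 'a \<Rightarrow> complex"
  assumes J: "finite J" and indep: "indep_vars (\<lambda>_. borel) X J"
    and mgf: "\<And>i z. i \<in> J \<Longrightarrow>
      (\<integral>\<^sup>+ \<omega>. ennreal (exp (Re (z * X i \<omega>))) \<partial>M) \<le> ennreal (exp (s\<^sup>2 * (cmod z)\<^sup>2 / 2))"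
  shows "(\<integral>\<^sup>+ \<omega>. ennreal (exp (Re (z * (\<Sum>i\<in>J. a i * X i \<omega>)))) \<partial>M)
    \<le> ennreal (exp (s\<^sup>2 * (cmod z)\<^sup>2 * (\<Sum>i\<in>J. (cmod (a i))\<^sup>2) / 2))"
proof -
  have eq: "ennreal (exp (Re (z * (\<Sum>i\<in>J. a i * X i \<omega>)))) = (\<Prod>i\<in>J. ennreal (exp (Re ((z * a i) * X i \<omega>))))" for \<omega>
  proof -
    have "Re (z * (\<Sum>i\<in>J. a i * X i \<omega>)) = (\<Sum>i\<in>J. Re ((z * a i) * X i \<omega>))"
      by (simp only: sum_distrib_left mult.assoc Re_sum)
    then show ?thesis using J by (simp only: exp_sum prod_ennreal exp_ge_zero)
  qed
  have ind: "indep_vars (\<lambda>_. borel) (\<lambda>i \<omega>. ennreal (exp (Re ((z * a i) * X i \<omega>)))) J"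
    by (rule indep_vars_compose2[OF indep, where Y = "\<lambda>i x. ennreal (exp (Re ((z * a i) * x)))"]) measurable
  have "(\<integral>\<^sup>+ \<omega>. ennreal (exp (Re (z * (\<Sum>i\<in>J. a i * X i \<omega>)))) \<partial>M)
      = (\<Prod>i\<in>J. \<integral>\<^sup>+ \<omega>. ennreal (exp (Re ((z * a i) * X i \<omega>))) \<partial>M)"
    unfolding eq by (intro indep_vars_nn_integral J ind) simp
  also have "\<dots> \<le> (\<Prod>i\<in>J. ennreal (exp (s\<^sup>2 * (cmod (z * a i))\<^sup>2 / 2)))"
    by (intro ennreal_prod_mono mgf)
  also have "\<dots> = ennreal (exp (\<Sum>i\<in>J. s\<^sup>2 * (cmod (z * a i))\<^sup>2 / 2))"
    using J by (simp only: exp_sum prod_ennreal exp_ge_zero)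
  also have "(\<Sum>i\<in>J. s\<^sup>2 * (cmod (z * a i))\<^sup>2 / 2) = s\<^sup>2 * (cmod z)\<^sup>2 * (\<Sum>i\<in>J. (cmod (a i))\<^sup>2) / 2"
    by (simp add: norm_mult power_mult_distrib sum_distrib_left sum_divide_distrib mult_ac)
  finally show ?thesis .
qed

text \<open>Since \<open>cmod S \<le> \<bar>Re S\<bar> + \<bar>Im S\<bar>\<close>, a modulus of at
  least \<open>2 * t\<close> forces \<open>Re (u * S) \<ge> t\<close> for one of the four directions
  in \<open>U\<close>; Markov's inequality for each of them gives the factor 4. The parameter
  \<open>x\<close> is left to the caller.\<close>

lemma chernoff_sum:
  fixes X :: "'i \<Rightarrow> 'a \<Rightarrow> complex"
  assumes J: "finite J" and indep: "indep_vars (\<lambda>_. borel) X J"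
    and mgf: "\<And>i z. i \<in> J \<Longrightarrow>
      (\<integral>\<^sup>+ \<omega>. ennreal (exp (Re (z * X i \<omega>))) \<partial>M) \<le> ennreal (exp (s\<^sup>2 * (cmod z)\<^sup>2 / 2))"
    and x: "0 \<le> x"
  shows "emeasure M {\<omega> \<in> space M. 2 * t \<le> cmod (\<Sum>i\<in>J. a i * X i \<omega>)}
    \<le> ennreal (4 * exp (s\<^sup>2 * x\<^sup>2 * (\<Sum>i\<in>J. (cmod (a i))\<^sup>2) / 2 - x * t))"
proof -
  define S where "S = (\<lambda>\<omega>. \<Sum>i\<in>J. a i * X i \<omega>)"
  define U where "U = {1, - 1, \<i>, - \<i>}"
  have finU: "finite U" and cardU: "card U = 4"
    by (auto simp: U_def complex_eq_iff)
  have [measurable]: "X i \<in> borel_measurable M" if "i \<in> J" for i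
    using indep that by (auto simp: indep_vars_def)
  have S [measurable]: "S \<in> borel_measurable M" unfolding S_def by measurable
  have pt: "indicator {\<omega> \<in> space M. 2 * t \<le> cmod (S \<omega>)} \<omega> \<le>
      (\<Sum>u\<in>U. ennreal (exp (- (x * t))) * ennreal (exp (Re ((of_real x * u) * S \<omega>))))" for \<omega>
  proof (cases "2 * t \<le> cmod (S \<omega>)")
    case True
    have "\<exists>u\<in>U. t \<le> Re (u * S \<omega>)"
      using True cmod_le[of "S \<omega>"] unfolding U_def by auto
    then obtain u where u: "u \<in> U" "t \<le> Re (u * S \<omega>)" by blast
    have "x * t \<le> x * Re (u * S \<omega>)" using u x by (intro mult_left_mono)
    also have "x * Re (u * S \<omega>) = Re ((of_real x * u) * S \<omega>)" by (simp add: algebra_simps)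
    finally have "0 \<le> - (x * t) + Re ((of_real x * u) * S \<omega>)" by simp
    then have "1 \<le> exp (- (x * t) + Re ((of_real x * u) * S \<omega>))" by (simp only: one_le_exp_iff)
    then have "1 \<le> ennreal (exp (- (x * t)) * exp (Re ((of_real x * u) * S \<omega>)))"
      by (simp only: exp_add ennreal_ge_1)
    then have "1 \<le> ennreal (exp (- (x * t))) * ennreal (exp (Re ((of_real x * u) * S \<omega>)))"
      by (simp only: ennreal_mult exp_ge_zero)
    also have "\<dots> \<le> (\<Sum>u\<in>U. ennreal (exp (- (x * t))) * ennreal (exp (Re ((of_real x * u) * S \<omega>))))"
      using finU u(1) by (intro member_le_sum) auto
    finally show ?thesis by (auto simp: indicator_def)
  qed (simp add: indicator_def)
  have "emeasure M {\<omega> \<in> space M. 2 * t \<le> cmod (S \<omega>)}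
      = (\<integral>\<^sup>+ \<omega>. indicator {\<omega> \<in> space M. 2 * t \<le> cmod (S \<omega>)} \<omega> \<partial>M)"
    by (intro nn_integral_indicator[symmetric]) measurable
  also have "\<dots> \<le> (\<integral>\<^sup>+ \<omega>. (\<Sum>u\<in>U. ennreal (exp (- (x * t))) * ennreal (exp (Re ((of_real x * u) * S \<omega>)))) \<partial>M)"
    by (intro nn_integral_mono pt)
  also have "\<dots> = (\<Sum>u\<in>U. ennreal (exp (- (x * t))) * (\<integral>\<^sup>+ \<omega>. ennreal (exp (Re ((of_real x * u) * S \<omega>))) \<partial>M))"
    by (subst nn_integral_sum) (auto intro!: sum.cong nn_integral_cmult)
  also have "\<dots> \<le> (\<Sum>u\<in>U. ennreal (exp (- (x * t))) * ennreal (exp (s\<^sup>2 * x\<^sup>2 * (\<Sum>i\<in>J. (cmod (a i))\<^sup>2) / 2)))"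
  proof (intro sum_mono mult_left_mono)
    fix u assume "u \<in> U"
    then have "cmod u = 1" by (auto simp: U_def)
    then show "(\<integral>\<^sup>+ \<omega>. ennreal (exp (Re ((of_real x * u) * S \<omega>))) \<partial>M)
        \<le> ennreal (exp (s\<^sup>2 * x\<^sup>2 * (\<Sum>i\<in>J. (cmod (a i))\<^sup>2) / 2))"
      using mgf_sum[OF J indep mgf, of "of_real x * u" a] by (simp add: S_def norm_mult)
  qed auto
  also have "\<dots> = ennreal (4 * exp (s\<^sup>2 * x\<^sup>2 * (\<Sum>i\<in>J. (cmod (a i))\<^sup>2) / 2 - x * t))"
  proof -
    have "(\<Sum>u\<in>U. ennreal b * ennreal c) = ennreal (4 * (b * c))" if "0 \<le> b" "0 \<le> c" for b c
      using that by (simp add: cardU ennreal_mult flip: ennreal_numeral)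
    then show ?thesis by (simp add: mult_exp_exp)
  qed
  finally show ?thesis by (simp add: S_def)
qed

text \<open>At level \<open>k\<close> the coefficients above \<open>k\<^bsup>-1/r'\<^esup>\<close> are summed
  absolutely, using boundedness of the variables, and the remaining ones by the Chernoff bound.\<close>

lemma tail_sum:
  fixes X :: "'i \<Rightarrow> 'a \<Rightarrow> complex"
  assumes J: "finite J" and indep: "indep_vars (\<lambda>_. borel) X J"
    and mgf: "\<And>i z. i \<in> J \<Longrightarrow>
      (\<integral>\<^sup>+ \<omega>. ennreal (exp (Re (z * X i \<omega>))) \<partial>M) \<le> ennreal (exp (s\<^sup>2 * (cmod z)\<^sup>2 / 2))"
    and r: "2 \<le> r" "1 / r + 1 / r' = 1"
    and bdd: "r > 2 \<Longrightarrow> AE \<omega> in M. \<forall>i\<in>J. cmod (X i \<omega>) \<le> B" and B: "0 \<le> B"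
    and a: "(\<Sum>i\<in>J. cmod (a i) powr r') \<le> 1"
    and k: "k > 0"
  shows "emeasure M {\<omega> \<in> space M. (B + 2 + s\<^sup>2) * real k powr (1 / r) \<le> cmod (\<Sum>i\<in>J. a i * X i \<omega>)}
    \<le> ennreal (4 * exp (- real k))"
proof -
  have inv: "1 / r' = 1 - 1 / r" using r by simp
  have "1 / r \<le> 1 / 2" "0 < 1 / r" using r(1) by (auto simp: field_simps)
  then have b: "1 / 2 \<le> 1 / r'" "1 / r' < 1" using inv by auto
  have r'0: "r' > 0" using b(1) zero_less_divide_1_iff[of r'] by linarith
  have r': "1 < r'" "r' \<le> 2" using b r'0 by (auto simp: field_simps)
  define \<theta> where "\<theta> = real k powr (- (1 / r'))"
  have \<theta>: "\<theta> > 0" using k by (simp add: \<theta>_def)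
  \<comment> \<open>For \<open>r = 2\<close> this set is empty, since no bound on the variables is
    then at hand; all coefficients go to the Chernoff bound.\<close>
  define J1 where "J1 = {i\<in>J. r > 2 \<and> cmod (a i) > \<theta>}"
  define J2 where "J2 = J - J1"
  have J12: "J = J1 \<union> J2" "J1 \<inter> J2 = {}" "finite J1" "finite J2" "J1 \<subseteq> J" "J2 \<subseteq> J"
    using J by (auto simp: J1_def J2_def)
  have le1: "(\<Sum>i\<in>K. cmod (a i) powr r') \<le> 1" if "K \<subseteq> J" for K
    using sum_mono2[OF J that, of "\<lambda>i. cmod (a i) powr r'"] a by auto
  \<comment> \<open>As \<open>1 - r'\<close> is negative,
    \<open>cmod (a i) powr (1 - r') \<le> \<theta> powr (1 - r')\<close> above the threshold;
    \<theta> is chosen so that the right-hand side is \<open>k powr (1 / r)\<close>, the order of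
    the tail level.\<close>
  have sum1: "(\<Sum>i\<in>J1. cmod (a i)) \<le> real k powr (1 / r)"
  proof -
    have "(\<Sum>i\<in>J1. cmod (a i)) \<le> (\<Sum>i\<in>J1. cmod (a i) powr r' * \<theta> powr (1 - r'))"
    proof (rule sum_mono)
      fix i assume "i \<in> J1"
      then have i: "\<theta> < cmod (a i)" by (simp add: J1_def)
      have "cmod (a i) = cmod (a i) powr r' * cmod (a i) powr (1 - r')"
        using i \<theta> by (simp flip: powr_add)
      also have "\<dots> \<le> cmod (a i) powr r' * \<theta> powr (1 - r')"
        using i \<theta> r' by (intro mult_left_mono powr_mono2') auto
      finally show "cmod (a i) \<le> cmod (a i) powr r' * \<theta> powr (1 - r')" .
    qed
    also have "\<dots> \<le> 1 * \<theta> powr (1 - r')"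
      unfolding sum_distrib_right[symmetric] by (intro mult_right_mono le1 J12) auto
    also have "\<theta> powr (1 - r') = real k powr (1 / r)"
    proof -
      have "- (1 / r') * (1 - r') = 1 / r" using r'0 inv by (simp add: field_simps)
      then show ?thesis unfolding \<theta>_def powr_powr by (simp only:)
    qed
    finally show ?thesis by simp
  qed
  have sum2: "(\<Sum>i\<in>J2. (cmod (a i))\<^sup>2) \<le> \<theta> powr (2 - r')"
  proof -
    have "(\<Sum>i\<in>J2. (cmod (a i))\<^sup>2) \<le> (\<Sum>i\<in>J2. cmod (a i) powr r' * \<theta> powr (2 - r'))"
    proof (rule sum_mono)
      fix i assume "i \<in> J2"
      then have i: "r = 2 \<or> cmod (a i) \<le> \<theta>" using r(1) by (auto simp: J1_def J2_def)
      show "(cmod (a i))\<^sup>2 \<le> cmod (a i) powr r' * \<theta> powr (2 - r')"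
      proof (cases "a i = 0")
        case False
        have "(cmod (a i))\<^sup>2 = cmod (a i) powr r' * cmod (a i) powr (2 - r')"
          using False by (simp flip: powr_add)
        also have "\<dots> \<le> cmod (a i) powr r' * \<theta> powr (2 - r')"
        proof (cases "r = 2")
          case True
          then have "r' = 2" using r by (simp add: field_simps)
          then show ?thesis using False \<theta> by simp
        next
          case False
          then show ?thesis using i r' by (intro mult_left_mono powr_mono2) auto
        qed
        finally show ?thesis .
      qed simp
    qed
    also have "\<dots> \<le> 1 * \<theta> powr (2 - r')"
      unfolding sum_distrib_right[symmetric] by (intro mult_right_mono le1 J12) auto
    finally show ?thesis by simp
  qed
  \<comment> \<open>With this \<open>x\<close> the term \<open>x^2\<close> times the sum of squares
    is at most \<open>k\<close>, and \<open>x * t\<close> is \<open>(1 + s^2 / 2) * k\<close>, so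
    the Chernoff exponent is at most \<open>s^2 * k / 2 - (1 + s^2 / 2) * k = - k\<close>. The part
    \<open>2 + s^2\<close> of the constant is \<open>2 * t\<close> at \<open>k = 1\<close>.\<close>
  define x where "x = real k powr (1 - 1 / r)"
  define t where "t = (1 + s\<^sup>2 / 2) * real k powr (1 / r)"
  have xt: "x * t = (1 + s\<^sup>2 / 2) * real k"
  proof -
    have "x * t = (1 + s\<^sup>2 / 2) * (real k powr (1 - 1 / r) * real k powr (1 / r))" by (simp add: x_def t_def)
    also have "real k powr (1 - 1 / r) * real k powr (1 / r) = real k" using k by (simp flip: powr_add)
    finally show ?thesis .
  qed
  have "x\<^sup>2 * (\<Sum>i\<in>J2. (cmod (a i))\<^sup>2) \<le> x\<^sup>2 * \<theta> powr (2 - r')" by (intro mult_left_mono sum2) auto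
  also have "\<dots> = real k powr ((1 - 1 / r) + (1 - 1 / r) + (- (1 / r')) * (2 - r'))"
    unfolding x_def \<theta>_def power2_eq_square powr_powr powr_add ..
  also have "(1 - 1 / r) + (1 - 1 / r) + (- (1 / r')) * (2 - r') = 1"
  proof -
    have "(- (1 / r')) * (2 - r') = 1 - 2 * (1 / r')" using r'0 by (simp add: field_simps)
    then show ?thesis using inv by simp
  qed
  finally have var: "x\<^sup>2 * (\<Sum>i\<in>J2. (cmod (a i))\<^sup>2) \<le> real k" by simp
  have [measurable]: "X i \<in> borel_measurable M" if "i \<in> J" for i
    using indep that by (auto simp: indep_vars_def)
  have [measurable]: "(\<lambda>\<omega>. \<Sum>i\<in>K. a i * X i \<omega>) \<in> borel_measurable M" if "K \<subseteq> J" for K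
    using that by (intro borel_measurable_sum) auto
  have ae: "AE \<omega> in M. cmod (\<Sum>i\<in>J1. a i * X i \<omega>) \<le> B * real k powr (1 / r)"
  proof (cases "r > 2")
    case True
    from bdd[OF this] show ?thesis
    proof (rule AE_mp, intro AE_I2 impI)
      fix \<omega> assume b: "\<forall>i\<in>J. cmod (X i \<omega>) \<le> B"
      have "cmod (\<Sum>i\<in>J1. a i * X i \<omega>) \<le> (\<Sum>i\<in>J1. cmod (a i) * B)"
        using b J12 by (intro sum_norm_le) (auto simp: norm_mult intro!: mult_left_mono)
      also have "\<dots> = B * (\<Sum>i\<in>J1. cmod (a i))" by (simp add: sum_distrib_left mult.commute)
      also have "\<dots> \<le> B * real k powr (1 / r)" by (intro mult_left_mono sum1 B)
      finally show "cmod (\<Sum>i\<in>J1. a i * X i \<omega>) \<le> B * real k powr (1 / r)" .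
    qed
  next
    case False
    then have "J1 = {}" by (auto simp: J1_def)
    then show ?thesis using B by simp
  qed
  have "emeasure M {\<omega> \<in> space M. (B + 2 + s\<^sup>2) * real k powr (1 / r) \<le> cmod (\<Sum>i\<in>J. a i * X i \<omega>)}
      \<le> emeasure M {\<omega> \<in> space M. 2 * t \<le> cmod (\<Sum>i\<in>J2. a i * X i \<omega>)}"
  proof (rule emeasure_mono_AE)
    show "AE \<omega> in M. \<omega> \<in> {\<omega> \<in> space M. (B + 2 + s\<^sup>2) * real k powr (1 / r) \<le> cmod (\<Sum>i\<in>J. a i * X i \<omega>)} \<longrightarrow>
       \<omega> \<in> {\<omega> \<in> space M. 2 * t \<le> cmod (\<Sum>i\<in>J2. a i * X i \<omega>)}"
      using ae
    proof (rule AE_mp, intro AE_I2 impI)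
      fix \<omega> assume 1: "cmod (\<Sum>i\<in>J1. a i * X i \<omega>) \<le> B * real k powr (1 / r)"
        and 2: "\<omega> \<in> {\<omega> \<in> space M. (B + 2 + s\<^sup>2) * real k powr (1 / r) \<le> cmod (\<Sum>i\<in>J. a i * X i \<omega>)}"
      have "(\<Sum>i\<in>J. a i * X i \<omega>) = (\<Sum>i\<in>J1. a i * X i \<omega>) + (\<Sum>i\<in>J2. a i * X i \<omega>)"
        using J12 by (metis sum.union_disjoint)
      then have "cmod (\<Sum>i\<in>J. a i * X i \<omega>) \<le> cmod (\<Sum>i\<in>J1. a i * X i \<omega>) + cmod (\<Sum>i\<in>J2. a i * X i \<omega>)"
        by (simp add: norm_triangle_ineq)
      moreover have "(B + 2 + s\<^sup>2) * real k powr (1 / r) = B * real k powr (1 / r) + 2 * t"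
        by (simp add: t_def algebra_simps)
      ultimately show "\<omega> \<in> {\<omega> \<in> space M. 2 * t \<le> cmod (\<Sum>i\<in>J2. a i * X i \<omega>)}" using 1 2 by simp
    qed
    show "{\<omega> \<in> space M. 2 * t \<le> cmod (\<Sum>i\<in>J2. a i * X i \<omega>)} \<in> sets M"
      using J12(6) by measurable
  qed
  also have "\<dots> \<le> ennreal (4 * exp (s\<^sup>2 * x\<^sup>2 * (\<Sum>i\<in>J2. (cmod (a i))\<^sup>2) / 2 - x * t))"
    using J12 by (intro chernoff_sum indep_vars_subset[OF indep] mgf) (auto simp: x_def)
  also have "\<dots> \<le> ennreal (4 * exp (- real k))"
  proof (intro ennreal_leI mult_left_mono)
    have "s\<^sup>2 * (x\<^sup>2 * (\<Sum>i\<in>J2. (cmod (a i))\<^sup>2)) \<le> s\<^sup>2 * real k" by (intro mult_left_mono var) auto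
    then show "exp (s\<^sup>2 * x\<^sup>2 * (\<Sum>i\<in>J2. (cmod (a i))\<^sup>2) / 2 - x * t) \<le> exp (- real k)"
      unfolding xt by (simp add: algebra_simps)
  qed auto
  finally show ?thesis .
qed

text \<open>If \<open>k\<close> is the integer part of \<open>(f \<omega> / D) powr r\<close>, the
  integrand is at most \<open>exp ((k + 1) / 2)\<close>, while the event \<open>E k\<close> has
  probability at most \<open>4 * exp (- k)\<close>. The factor 1/2 in the exponent thus leaves a
  geometric series of ratio \<open>exp (- 1 / 2)\<close>.\<close>

lemma exp_moment_of_tail:
  fixes f :: "'a \<Rightarrow> real"
  assumes f [measurable]: "f \<in> borel_measurable M" and f0: "\<And>\<omega>. 0 \<le> f \<omega>"
    and D: "0 < D" and r: "0 < r"
    and tail: "\<And>k::nat. k > 0 \<Longrightarrow>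
      emeasure M {\<omega> \<in> space M. D * real k powr (1 / r) \<le> f \<omega>} \<le> ennreal (4 * exp (- real k))"
  shows "(\<integral>\<^sup>+ \<omega>. ennreal (exp ((f \<omega> / D) powr r / 2)) \<partial>M) \<le> 32"
proof -
  define E where "E = (\<lambda>k::nat. {\<omega> \<in> space M. D * real k powr (1 / r) \<le> f \<omega>})"
  define q :: real where "q = exp (- 1 / 2)"
  have [measurable]: "E k \<in> sets M" for k unfolding E_def by measurable
  have q2: "q\<^sup>2 = inverse (exp 1)" unfolding q_def using exp_of_nat_mult[of 2 "- (1 / 2) :: real"] by (simp add: exp_minus)
  \<comment> \<open>From \<open>2 \<le> exp 1 \<le> 3\<close> one gets \<open>1/2 < q < 3/4\<close>,
    hence \<open>q * (1 - q) \<ge> 1/8\<close>, and the series \<open>4 / (q * (1 - q))\<close> is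
    at most 32.\<close>
  have q34: "q < 3 / 4"
  proof (rule power_less_imp_less_base[of _ 2])
    have "inverse (exp (1::real)) \<le> inverse 2"
      using exp_ge_add_one_self[of 1] by (intro le_imp_inverse_le) auto
    then show "q\<^sup>2 < (3/4)\<^sup>2" unfolding q2 by (simp add: power2_eq_square)
  qed simp
  have q12: "1 / 2 < q"
  proof (rule power_less_imp_less_base[of _ 2])
    have "inverse (3::real) \<le> inverse (exp 1)"
      using exp_le by (intro le_imp_inverse_le) auto
    then show "(1/2)\<^sup>2 < q\<^sup>2" unfolding q2 by (simp add: power2_eq_square)
  qed (simp add: q_def)
  have level: "ennreal (exp ((real k + 1) / 2)) * emeasure M (E k) \<le> ennreal (4 / q * q ^ k)" for k
  proof -
    \<comment> \<open>The hypothesis \<open>tail\<close> starts at \<open>k = 1\<close>; for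
      \<open>k = 0\<close> the trivial bound 1 suffices.\<close>
    have "emeasure M (E k) \<le> ennreal (4 * exp (- real k))"
    proof (cases "k = 0")
      case True
      have "emeasure M (E k) \<le> 1" by (rule measure_le_1)
      also have "1 \<le> ennreal (4 * exp (- real k))" using True by simp
      finally show ?thesis .
    qed (use tail[of k] in \<open>auto simp: E_def\<close>)
    then have "ennreal (exp ((real k + 1) / 2)) * emeasure M (E k)
        \<le> ennreal (exp ((real k + 1) / 2)) * ennreal (4 * exp (- real k))" by (intro mult_left_mono) auto
    also have "\<dots> = ennreal (4 * (exp ((real k + 1) / 2) * exp (- real k)))"
      by (simp add: mult_ac flip: ennreal_mult)
    also have "exp ((real k + 1) / 2) * exp (- real k) = exp (- (- 1 / 2) + real k * (- 1 / 2))"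
      by (simp add: field_simps flip: exp_add)
    also have "\<dots> = q ^ k / q" unfolding exp_add q_def exp_of_nat_mult by (simp add: exp_minus field_simps)
    finally show ?thesis by simp
  qed
  have pt: "ennreal (exp ((f \<omega> / D) powr r / 2)) \<le> (\<Sum>k. ennreal (exp ((real k + 1) / 2)) * indicator (E k) \<omega>)"
    if \<omega>: "\<omega> \<in> space M" for \<omega>
  proof -
    define y where "y = (f \<omega> / D) powr r"
    define k where "k = nat \<lfloor>y\<rfloor>"
    have "y \<ge> 0" by (simp add: y_def)
    then have k: "real k \<le> y" "y \<le> real k + 1" unfolding k_def by linarith+
    have "real k powr (1 / r) \<le> y powr (1 / r)" using k r by (intro powr_mono2) auto
    also have "\<dots> = f \<omega> / D" unfolding y_def powr_powr using f0[of \<omega>] D r by simp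
    finally have "\<omega> \<in> E k" using D \<omega> by (simp add: E_def field_simps)
    then have "ennreal (exp (y / 2)) \<le> ennreal (exp ((real k + 1) / 2)) * indicator (E k) \<omega>"
      using k by (auto intro!: ennreal_leI)
    also have "\<dots> = (\<Sum>j\<in>{k}. ennreal (exp ((real j + 1) / 2)) * indicator (E j) \<omega>)"
      by (simp del: sum_mult_indicator sum_indicator_mult)
    also have "\<dots> \<le> (\<Sum>k. ennreal (exp ((real k + 1) / 2)) * indicator (E k) \<omega>)"
      by (intro sum_le_suminf summableI) auto
    finally show ?thesis by (simp add: y_def)
  qed
  have "(\<integral>\<^sup>+ \<omega>. ennreal (exp ((f \<omega> / D) powr r / 2)) \<partial>M)
      \<le> (\<integral>\<^sup>+ \<omega>. (\<Sum>k. ennreal (exp ((real k + 1) / 2)) * indicator (E k) \<omega>) \<partial>M)"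
    by (intro nn_integral_mono pt)
  also have "\<dots> = (\<Sum>k. ennreal (exp ((real k + 1) / 2)) * emeasure M (E k))"
    by (subst nn_integral_suminf) (auto simp: nn_integral_cmult_indicator)
  also have "\<dots> \<le> (\<Sum>k. ennreal (4 / q * q ^ k))"
    by (intro suminf_le level summableI)
  also have "\<dots> = ennreal (4 / q * (1 / (1 - q)))"
    using q12 q34 by (intro suminf_ennreal_eq sums_mult geometric_sums) auto
  also have "\<dots> \<le> 32"
  proof -
    have "1 / 2 * (1 / 4) \<le> q * (1 - q)" using q12 q34 by (intro mult_mono) auto
    then have "4 / q * (1 / (1 - q)) \<le> 32" using q12 q34 by (simp add: field_simps)
    then show ?thesis by (metis ennreal_leI ennreal_numeral zero_le_numeral)
  qed
  finally show ?thesis .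
qed

text \<open>The power \<open>1/q\<close> that turns the union bound \<open>32 card F\<close> into a constant is taken by
  Bernoulli's inequality.\<close>

lemma orlicz_norm_max:
  fixes f :: "'b \<Rightarrow> 'a \<Rightarrow> real"
  assumes F: "finite F" "F \<noteq> {}"
    and f [measurable]: "\<And>w. w \<in> F \<Longrightarrow> f w \<in> borel_measurable M" and f0: "\<And>w \<omega>. 0 \<le> f w \<omega>"
    and D: "0 < D" and r: "0 < r"
    and moment: "\<And>w. w \<in> F \<Longrightarrow> (\<integral>\<^sup>+ \<omega>. ennreal (exp ((f w \<omega> / D) powr r / 2)) \<partial>M) \<le> 32"
    and G: "\<And>\<omega>. \<omega> \<in> space M \<Longrightarrow> \<bar>G \<omega>\<bar> \<le> 2 * (MAX w\<in>F. f w \<omega>)"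
    and q: "2 \<le> q" "32 * real (card F) \<le> 2 ^ q"
  shows "orlicz_norm r M G \<le> ennreal (2 * D * (2 * real q) powr (1 / r))"
proof -
  \<comment> \<open>The leading 2 compensates the 2 in \<open>G\<close>. The factor
    \<open>(2 * q) powr (1 / r)\<close> makes
    \<open>(\<bar>G \<omega>\<bar> / \<epsilon>) powr r\<close> at most \<open>(Y / 2) / q\<close>,
    so its exponential is at most the \<open>q\<close>-th root of the integrand in
    \<open>moment\<close>.\<close>
  define \<epsilon> where "\<epsilon> = 2 * D * (2 * real q) powr (1 / r)"
  define B where "B = 32 * real (card F)"
  have B: "B > 0" using F by (simp add: B_def card_gt_0_iff)
  have \<epsilon>: "\<epsilon> > 0" using D q by (simp add: \<epsilon>_def)
  have pt: "ennreal (phi r (\<bar>G \<omega>\<bar> / \<epsilon>)) \<le>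
      ennreal (1 - 2 / q) + (\<Sum>w\<in>F. ennreal (2 / (q * B)) * ennreal (exp ((f w \<omega> / D) powr r / 2)))"
    if \<omega>: "\<omega> \<in> space M" for \<omega>
  proof -
    obtain w where w: "w \<in> F" "(MAX w\<in>F. f w \<omega>) = f w \<omega>"
      using Max_in[of "(\<lambda>w. f w \<omega>) ` F"] F by (smt (verit) finite_imageI image_iff image_is_empty)
    define Y where "Y = (f w \<omega> / D) powr r"
    \<comment> \<open>Normalised by the union bound: summed over \<open>F\<close>, the expectations
      of these quantities are at most 1.\<close>
    define u where "u = exp (Y / 2) / B"
    have u: "u > 0" using B by (simp add: u_def)
    have "\<bar>G \<omega>\<bar> / \<epsilon> \<le> 2 * f w \<omega> / \<epsilon>" using G[OF \<omega>] w \<epsilon> by (intro divide_right_mono) auto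
    also have "\<dots> = (f w \<omega> / D) * (1 / (2 * real q) powr (1 / r))" using D by (simp add: \<epsilon>_def)
    finally have "(\<bar>G \<omega>\<bar> / \<epsilon>) powr r \<le> ((f w \<omega> / D) * (1 / (2 * real q) powr (1 / r))) powr r"
      using r \<epsilon> by (intro powr_mono2) auto
    also have "\<dots> = Y * (1 / (2 * real q) powr (1 / r)) powr r"
      unfolding Y_def using f0[of w \<omega>] D by (intro powr_mult)
    also have "(1 / (2 * real q) powr (1 / r)) powr r = 1 / (2 * real q)"
      using r q by (simp add: powr_divide powr_powr)
    finally have 1: "(\<bar>G \<omega>\<bar> / \<epsilon>) powr r \<le> Y / (2 * real q)" by simp
    \<comment> \<open>As \<open>B \<le> 2 ^ q\<close>, the \<open>q\<close>-th root of
      \<open>B * u\<close> is at most twice that of \<open>u\<close>, which is then linearised. So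
      \<open>phi\<close> is at most \<open>1 - 2/q + (2/q) * u\<close>, and summing over
      \<open>F\<close> makes the expectation at most 1; \<open>q \<ge> 2\<close> keeps the constant
      term nonnegative.\<close>
    have "exp (Y / (2 * real q)) \<le> 2 * (1 + (u - 1) / q)"
    proof (rule power_le_imp_le_base[of _ "q - 1"])
      have "exp (Y / (2 * real q)) ^ q = exp (Y / 2)"
        using q by (simp flip: exp_of_nat_mult)
      also have "\<dots> = B * u" using B by (simp add: u_def)
      also have "\<dots> \<le> 2 ^ q * u" using q u by (intro mult_right_mono) (auto simp: B_def)
      also have "\<dots> = 2 ^ q * (1 + real q * ((u - 1) / q))" using q by simp
      also have "\<dots> \<le> 2 ^ q * (1 + (u - 1) / q) ^ q"
        using q u by (intro mult_left_mono Bernoulli_inequality) (auto simp: field_simps)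
      also have "\<dots> = (2 * (1 + (u - 1) / q)) ^ q" by (simp only: power_mult_distrib)
      finally show "exp (Y / (2 * real q)) ^ Suc (q - 1) \<le> (2 * (1 + (u - 1) / q)) ^ Suc (q - 1)"
        using q by simp
      show "0 \<le> 2 * (1 + (u - 1) / q)" using q u by (simp add: field_simps)
    qed
    also have "\<dots> = 2 - 2 / q + 2 / (q * B) * exp (Y / 2)"
      using q B by (simp add: u_def field_simps)
    finally have "exp (Y / (2 * real q)) \<le> 2 - 2 / q + 2 / (q * B) * exp (Y / 2)" .
    with 1 have "phi r (\<bar>G \<omega>\<bar> / \<epsilon>) \<le> (1 - 2 / q) + 2 / (q * B) * exp (Y / 2)"
      unfolding phi_def using order_trans[of "exp ((\<bar>G \<omega>\<bar> / \<epsilon>) powr r)" "exp (Y / (2 * real q))"] by fastforce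
    then have "ennreal (phi r (\<bar>G \<omega>\<bar> / \<epsilon>)) \<le> ennreal ((1 - 2 / q) + 2 / (q * B) * exp (Y / 2))"
      by (rule ennreal_leI)
    also have "\<dots> = ennreal (1 - 2 / q) + ennreal (2 / (q * B)) * ennreal (exp (Y / 2))"
      using q B by (simp add: ennreal_plus ennreal_mult[symmetric] del: times_divide_eq_left)
    also have "ennreal (2 / (q * B)) * ennreal (exp (Y / 2)) \<le>
        (\<Sum>w\<in>F. ennreal (2 / (q * B)) * ennreal (exp ((f w \<omega> / D) powr r / 2)))"
      unfolding Y_def using F w(1) by (intro member_le_sum) auto
    finally show ?thesis by (simp add: add_left_mono)
  qed
  have "(\<integral>\<^sup>+ \<omega>. ennreal (phi r (\<bar>G \<omega>\<bar> / \<epsilon>)) \<partial>M) \<le>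
      (\<integral>\<^sup>+ \<omega>. (ennreal (1 - 2 / q) + (\<Sum>w\<in>F. ennreal (2 / (q * B)) * ennreal (exp ((f w \<omega> / D) powr r / 2)))) \<partial>M)"
    by (intro nn_integral_mono pt)
  also have "\<dots> = ennreal (1 - 2 / q) + (\<Sum>w\<in>F. ennreal (2 / (q * B)) * (\<integral>\<^sup>+ \<omega>. ennreal (exp ((f w \<omega> / D) powr r / 2)) \<partial>M))"
    by (subst nn_integral_add) (auto simp: emeasure_space_1 nn_integral_sum nn_integral_cmult intro!: sum.cong)
  also have "\<dots> \<le> ennreal (1 - 2 / q) + (\<Sum>w\<in>F. ennreal (2 / (q * B)) * 32)"
    by (intro add_left_mono sum_mono mult_left_mono moment) auto
  also have "(\<Sum>w\<in>F. ennreal (2 / (q * B)) * 32) = ennreal (2 / (q * B) * B)"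
  proof -
    have "(\<Sum>w\<in>F. ennreal (2 / (q * B)) * 32) = (\<Sum>w\<in>F. ennreal (2 / (q * B) * 32))"
      using ennreal_mult''[of 32 "2 / (q * B)"] by simp
    also have "\<dots> = ennreal (\<Sum>w\<in>F. 2 / (q * B) * 32)" using B by (intro sum_ennreal) auto
    also have "(\<Sum>w\<in>F. 2 / (q * B) * 32) = 2 / (q * B) * B" by (simp add: B_def)
    finally show ?thesis .
  qed
  also have "ennreal (1 - 2 / q) + ennreal (2 / (q * B) * B) = ennreal 1"
    using q B by (subst ennreal_plus[symmetric]) auto
  finally have "(\<integral>\<^sup>+ \<omega>. ennreal (phi r (\<bar>G \<omega>\<bar> / \<epsilon>)) \<partial>M) \<le> 1" by simp
  then show ?thesis unfolding orlicz_norm_def \<epsilon>_def[symmetric] using \<epsilon> by (intro Inf_lower) auto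
qed

end

section \<open>Random polynomials\<close>

text \<open>The multinomial theorem divided by \<open>fact k\<close>. In this form the summand is a
  product over coordinates: splitting off the first list entry leaves the same sum for the shifted
  \<open>x\<close>, and the binomial theorem closes the induction on \<open>n\<close>.\<close>

lemma multinomial_sum:
  fixes x :: "nat \<Rightarrow> real"
  shows "(\<Sum>\<alpha>\<in>{\<alpha>. length \<alpha> = n \<and> sum_list \<alpha> = k}. \<Prod>i<length \<alpha>. x i ^ (\<alpha> ! i) / fact (\<alpha> ! i))
    = (\<Sum>i<n. x i) ^ k / fact k"
proof (induction n arbitrary: x k)
  case 0
  have "{\<alpha>. length \<alpha> = 0 \<and> sum_list \<alpha> = k} = (if k = 0 then {[]} else {})" by auto
  then show ?case by (simp add: power_0_left)
next
  case (Suc n)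
  let ?I = "\<lambda>n k. {\<alpha>::nat list. length \<alpha> = n \<and> sum_list \<alpha> = k}"
  let ?t = "\<lambda>(x::nat \<Rightarrow> real) (\<alpha>::nat list). \<Prod>i<length \<alpha>. x i ^ (\<alpha> ! i) / fact (\<alpha> ! i)"
  have fin: "finite (?I n k)" for n k
    by (rule finite_subset[OF _ finite_multi_indices_le[of n k]]) auto
  have I: "?I (Suc n) k = (\<lambda>(j, \<beta>). j # \<beta>) ` (SIGMA j:{..k}. ?I n (k - j))"
  proof (intro equalityI subsetI)
    fix \<alpha> assume "\<alpha> \<in> ?I (Suc n) k"
    then show "\<alpha> \<in> (\<lambda>(j, \<beta>). j # \<beta>) ` (SIGMA j:{..k}. ?I n (k - j))"
      by (cases \<alpha>) (auto simp: image_iff Bex_def)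
  qed auto
  have "sum (?t x) (?I (Suc n) k) = (\<Sum>p\<in>(SIGMA j:{..k}. ?I n (k - j)). ?t x (fst p # snd p))"
    unfolding I by (subst sum.reindex) (auto simp: inj_on_def case_prod_beta)
  also have "\<dots> = (\<Sum>j\<le>k. \<Sum>\<beta>\<in>?I n (k - j). ?t x (j # \<beta>))"
    using fin by (subst sum.Sigma) (auto simp: case_prod_beta)
  also have "\<dots> = (\<Sum>j\<le>k. \<Sum>\<beta>\<in>?I n (k - j). x 0 ^ j / fact j * ?t (\<lambda>i. x (Suc i)) \<beta>)"
    by (simp only: length_Cons prod.lessThan_Suc_shift nth_Cons_0 nth_Cons_Suc)
  also have "\<dots> = (\<Sum>j\<le>k. x 0 ^ j / fact j * ((\<Sum>i<n. x (Suc i)) ^ (k - j) / fact (k - j)))"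
    by (simp only: sum_distrib_left[symmetric] Suc.IH)
  also have "\<dots> = (\<Sum>j\<le>k. of_nat (k choose j) * x 0 ^ j * (\<Sum>i<n. x (Suc i)) ^ (k - j) / fact k)"
    by (intro sum.cong refl) (simp add: binomial_fact)
  also have "\<dots> = (x 0 + (\<Sum>i<n. x (Suc i))) ^ k / fact k"
    by (simp only: binomial_ring sum_divide_distrib)
  finally show ?case by (simp only: sum.lessThan_Suc_shift)
qed

lemma power_powr_commute: "0 \<le> (x::real) \<Longrightarrow> (x ^ k) powr p = (x powr p) ^ k"
  by (induction k) (auto simp: powr_mult)

text \<open>The factor \<open>multi_fact \<alpha>\<close> is split off so that the rest is the
  summand of \<open>multinomial_sum\<close>; the factorials in the final estimate originate
  here.\<close>

lemma monomial_powr: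
  "cmod (monomial \<alpha> z) powr p = multi_fact \<alpha> * (\<Prod>i<length \<alpha>. (cmod (z i) powr p) ^ (\<alpha> ! i) / fact (\<alpha> ! i))"
  by (simp add: monomial_def multi_fact_def prod_norm[symmetric] prod_powr_distrib norm_power
      power_powr_commute prod_dividef)

context cnorm
begin

text \<open>Within degree \<open>k\<close> the quotients
  \<open>cmod (c \<alpha>) powr p * multi_fact \<alpha> / fact k\<close> are replaced by their
  supremum; what remains is \<open>fact k\<close> times the multinomial sum, a pure
  \<open>k\<close>-th power.\<close>

lemma coefficient_sum_bound:
  assumes n: "n > 0" and p: "0 \<le> p" and z: "z \<in> unit_ball n N"
  shows "(\<Sum>\<alpha>\<in>{\<alpha>. length \<alpha> = n \<and> sum_list \<alpha> \<le> m}. cmod (c \<alpha> * monomial \<alpha> z) powr p) \<le>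
    (\<Sum>k=0..m.
       (SUP \<alpha>\<in>{\<alpha>. length \<alpha> = n \<and> sum_list \<alpha> = k}. cmod (c \<alpha>) powr p * multi_fact \<alpha> / fact k) *
       (SUP z\<in>unit_ball n N. (\<Sum>i<n. cmod (z i) powr p) ^ k))"
proof -
  let ?I = "{\<alpha>. length \<alpha> = n \<and> sum_list \<alpha> \<le> m}"
  have fin: "finite {\<alpha>::nat list. length \<alpha> = n \<and> sum_list \<alpha> = k}" for k
    by (rule finite_subset[OF _ finite_multi_indices_le[of n k]]) auto
  obtain A where A: "A \<ge> 1" "\<And>z i. z \<in> unit_ball n N \<Longrightarrow> cmod (z i) \<le> A"
    by (rule ball_coord_bound) blast
  have "(\<Sum>\<alpha>\<in>?I. cmod (c \<alpha> * monomial \<alpha> z) powr p) =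
      (\<Sum>k=0..m. \<Sum>\<alpha>\<in>{\<alpha>\<in>?I. sum_list \<alpha> = k}. cmod (c \<alpha> * monomial \<alpha> z) powr p)"
    by (intro sum.group[symmetric] finite_multi_indices_le) auto
  also have "\<dots> \<le> (\<Sum>k=0..m.
       (SUP \<alpha>\<in>{\<alpha>. length \<alpha> = n \<and> sum_list \<alpha> = k}. cmod (c \<alpha>) powr p * multi_fact \<alpha> / fact k) *
       (SUP z\<in>unit_ball n N. (\<Sum>i<n. cmod (z i) powr p) ^ k))"
  proof (rule sum_mono)
    fix k assume "k \<in> {0..m}"
    then have eq: "{\<alpha>\<in>?I. sum_list \<alpha> = k} = {\<alpha>. length \<alpha> = n \<and> sum_list \<alpha> = k}" (is "_ = ?Ik") by auto
    define S where "S = (SUP \<alpha>\<in>?Ik. cmod (c \<alpha>) powr p * multi_fact \<alpha> / fact k)"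
    define y where "y = (\<lambda>\<alpha>. \<Prod>i<length \<alpha>. (cmod (z i) powr p) ^ (\<alpha> ! i) / fact (\<alpha> ! i))"
    have y0: "0 \<le> y \<alpha>" for \<alpha> unfolding y_def by (intro prod_nonneg) auto
    have S: "cmod (c \<alpha>) powr p * multi_fact \<alpha> / fact k \<le> S" if "\<alpha> \<in> ?Ik" for \<alpha>
      unfolding S_def using that fin by (intro cSUP_upper bdd_above_finite) auto
    \<comment> \<open>Some multi-index of degree \<open>k\<close> exists because
      \<open>n > 0\<close>, so \<open>S\<close> lies above a nonnegative quotient.\<close>
    have "k # replicate (n - 1) 0 \<in> ?Ik" using n by (simp add: sum_list_replicate)
    from S[OF this] have S0: "0 \<le> S"
      by (rule order_trans[rotated]) (auto simp: multi_fact_def intro!: divide_nonneg_pos mult_nonneg_nonneg prod_nonneg)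
    have "(\<Sum>\<alpha>\<in>?Ik. cmod (c \<alpha> * monomial \<alpha> z) powr p) \<le> (\<Sum>\<alpha>\<in>?Ik. S * fact k * y \<alpha>)"
    proof (rule sum_mono)
      fix \<alpha> assume \<alpha>: "\<alpha> \<in> ?Ik"
      have "cmod (c \<alpha> * monomial \<alpha> z) powr p = (cmod (c \<alpha>) powr p * multi_fact \<alpha> / fact k) * (fact k * y \<alpha>)"
        by (simp add: norm_mult powr_mult monomial_powr y_def)
      also have "\<dots> \<le> S * (fact k * y \<alpha>)" using y0 by (intro mult_right_mono S \<alpha>) auto
      finally show "cmod (c \<alpha> * monomial \<alpha> z) powr p \<le> S * fact k * y \<alpha>" by (simp add: mult.assoc)
    qed
    also have "\<dots> = S * (\<Sum>i<n. cmod (z i) powr p) ^ k"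
      unfolding sum_distrib_left[symmetric] y_def multinomial_sum by simp
    also have "\<dots> \<le> S * (SUP z\<in>unit_ball n N. (\<Sum>i<n. cmod (z i) powr p) ^ k)"
    proof (intro mult_left_mono cSUP_upper z S0 bdd_aboveI2)
      fix z assume "z \<in> unit_ball n N"
      then show "(\<Sum>i<n. cmod (z i) powr p) ^ k \<le> (\<Sum>i<n. A powr p) ^ k"
        using A p by (intro power_mono sum_mono powr_mono2 sum_nonneg) auto
    qed
    finally show "(\<Sum>\<alpha>\<in>{\<alpha>\<in>?I. sum_list \<alpha> = k}. cmod (c \<alpha> * monomial \<alpha> z) powr p) \<le>
       (SUP \<alpha>\<in>?Ik. cmod (c \<alpha>) powr p * multi_fact \<alpha> / fact k) *
       (SUP z\<in>unit_ball n N. (\<Sum>i<n. cmod (z i) powr p) ^ k)"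
      unfolding eq S_def .
  qed
  finally show ?thesis .
qed

end

text \<open>Only the logarithm of the covering number enters the estimate for a maximum;
  \<open>q\<close> is a generous upper bound for this logarithm to base 2.\<close>

lemma net_exponent:
  assumes m: "m > 0" and n: "n > 0" and L: "L \<le> ((48 * real m)\<^sup>2) ^ n"
  obtains q :: nat where "2 \<le> q" "32 * L \<le> 2 ^ q" "real q \<le> 19 * (real n * (1 + ln (real m)))"
proof -
  define j where "j = nat \<lceil>2 * ln (real m)\<rceil>"
  have l0: "0 \<le> ln (real m)" using m by simp
  have j: "2 * ln (real m) \<le> real j" "real j \<le> 2 * ln (real m) + 1" using l0 unfolding j_def by linarith+
  have "ln (real m) \<le> real j * (1 / 2)" using j by simp
  also have "\<dots> \<le> real j * ln 2" using ln2_ge_two_thirds by (intro mult_left_mono) auto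
  finally have "real m \<le> exp (real j * ln 2)" using m by (simp add: ln_le_cancel_iff[symmetric] del: ln_le_cancel_iff)
  also have "\<dots> = 2 ^ j" by (simp add: exp_of_nat_mult)
  finally have mj: "48 * real m \<le> 48 * 2 ^ j" by simp
  \<comment> \<open>Uses 32 = 2^5, 48 \<le> 2^6 and m \<le> 2^j with j \<le> 2 ln m + 1. Hence q
    \<le> 5 + 14 n + 4 n ln m, and \<open>n \<ge> 1\<close> gives the factor 19.\<close>
  define q where "q = 5 + 2 * (6 + j) * n"
  have "48 * real m \<le> 2 ^ (6 + j)" by (rule order_trans[OF mj]) (simp add: power_add)
  then have "((48 * real m)\<^sup>2) ^ n \<le> ((2 ^ (6 + j))\<^sup>2) ^ n" by (intro power_mono) auto
  then have "32 * L \<le> 2 ^ 5 * (((2 ^ (6 + j))\<^sup>2) ^ n)" using L by simp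
  also have "\<dots> = 2 ^ q" unfolding q_def power_mult[symmetric] power_add[symmetric] by (simp add: mult_ac)
  finally have 1: "32 * L \<le> 2 ^ q" .
  have "real q = 5 + 12 * real n + real n * (2 * real j)" by (simp add: q_def algebra_simps)
  also have "real n * (2 * real j) \<le> real n * (2 * (2 * ln (real m) + 1))" using j by (intro mult_left_mono) auto
  also have "5 + 12 * real n + real n * (2 * (2 * ln (real m) + 1)) \<le> 19 * (real n * (1 + ln (real m)))"
  proof -
    have "0 \<le> real n * ln (real m)" using l0 by simp
    then show ?thesis using n by (simp add: algebra_simps)
  qed
  finally have "real q \<le> 19 * (real n * (1 + ln (real m)))" by simp
  with 1 show ?thesis using that[of q] by (simp add: q_def)
qed

text \<open>Here \<sigma> is any positive bound, uniform over the ball, for the l_r' norm of the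
  terms \<open>c \<alpha> * monomial \<alpha> z\<close>; positivity permits dividing by it, since
  \<open>tail_sum\<close> is stated for norm at most 1.\<close>

lemma random_polynomial_bound:
  fixes P :: "'a measure" and \<gamma> :: "nat list \<Rightarrow> 'a \<Rightarrow> complex"
  assumes r: "2 \<le> r" "1 / r + 1 / r' = 1" and P: "prob_space P"
    and sub: "\<And>\<alpha>. \<alpha> \<in> multi_indices \<Longrightarrow> subgaussian P (\<gamma> \<alpha>)"
    and indep: "prob_space.indep_vars P (\<lambda>_. borel) \<gamma> multi_indices"
    and s: "\<And>\<alpha>. \<alpha> \<in> multi_indices \<Longrightarrow> sg P (\<gamma> \<alpha>) < s"
    and B: "0 \<le> B" "\<And>\<alpha>. r > 2 \<Longrightarrow> \<alpha> \<in> multi_indices \<Longrightarrow> AE \<omega> in P. cmod (\<gamma> \<alpha> \<omega>) \<le> B"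
    and m: "m > 0" and n: "n > 0" and N: "is_norm n N"
    and \<sigma>: "\<sigma> > 0"
    and c: "\<And>z. z \<in> unit_ball n N \<Longrightarrow>
      (\<Sum>\<alpha>\<in>{\<alpha>. length \<alpha> = n \<and> sum_list \<alpha> \<le> m}. cmod (c \<alpha> * monomial \<alpha> z) powr r') \<le> \<sigma> powr r'"
  shows "orlicz_norm r P
      (\<lambda>\<omega>. SUP z\<in>unit_ball n N. cmod (poly_fun n m (\<lambda>\<alpha>. \<gamma> \<alpha> \<omega> * c \<alpha>) z))
    \<le> ennreal (76 * (B + 2 + s\<^sup>2) * (real n * (1 + ln (real m))) powr (1 / r) * \<sigma>)"
proof -
  interpret prob_space P by (rule P)
  interpret cnorm n N by unfold_locales (rule N)
  let ?I = "{\<alpha>::nat list. length \<alpha> = n \<and> sum_list \<alpha> \<le> m}"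
  have I: "?I \<subseteq> multi_indices" using n by (auto simp: multi_indices_def Suc_le_eq)
  have finI: "finite ?I" by (rule finite_multi_indices_le)
  have ind: "indep_vars (\<lambda>_. borel) \<gamma> ?I" by (rule indep_vars_subset[OF indep I])
  have [measurable]: "\<gamma> \<alpha> \<in> borel_measurable P" if "\<alpha> \<in> ?I" for \<alpha>
    using sub[of \<alpha>] I that by (auto simp: subgaussian_def)
  obtain F where F: "finite F" "F \<noteq> {}" "F \<subseteq> unit_ball n N" "real (card F) \<le> ((48 * real m)\<^sup>2) ^ n"
    "\<And>b z. z \<in> unit_ball n N \<Longrightarrow> cmod (poly_fun n m b z) \<le> 2 * (MAX w\<in>F. cmod (poly_fun n m b w))"
    using poly_fun_net[OF m] by blast
  obtain q where q: "2 \<le> q" "32 * real (card F) \<le> 2 ^ q" "real q \<le> 19 * (real n * (1 + ln (real m)))"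
    using net_exponent[OF m n F(4)] by blast
  define D where "D = B + 2 + s\<^sup>2"
  have D: "D > 0" using B(1) by (simp add: D_def add_nonneg_pos add_pos_nonneg)
  define f where "f = (\<lambda>w \<omega>. cmod (poly_fun n m (\<lambda>\<alpha>. \<gamma> \<alpha> \<omega> * c \<alpha>) w))"
  have fm: "f w \<in> borel_measurable P" for w
    unfolding f_def poly_fun_def by measurable
  have moment: "(\<integral>\<^sup>+ \<omega>. ennreal (exp ((f w \<omega> / (D * \<sigma>)) powr r / 2)) \<partial>P) \<le> 32" if w: "w \<in> F" for w
  proof (rule exp_moment_of_tail)
    fix k :: nat assume k: "k > 0"
    define a where "a = (\<lambda>\<alpha>. c \<alpha> * monomial \<alpha> w / of_real \<sigma>)"
    have "(\<Sum>\<alpha>\<in>?I. cmod (a \<alpha>) powr r') = (\<Sum>\<alpha>\<in>?I. cmod (c \<alpha> * monomial \<alpha> w) powr r') / \<sigma> powr r'"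
      using \<sigma> by (simp add: a_def norm_divide powr_divide sum_divide_distrib)
    also have "\<dots> \<le> 1" using c[of w] w F(3) \<sigma> by (auto simp: divide_le_eq)
    finally have a: "(\<Sum>\<alpha>\<in>?I. cmod (a \<alpha>) powr r') \<le> 1" .
    have f: "f w \<omega> = \<sigma> * cmod (\<Sum>\<alpha>\<in>?I. a \<alpha> * \<gamma> \<alpha> \<omega>)" for \<omega>
    proof -
      have "poly_fun n m (\<lambda>\<alpha>. \<gamma> \<alpha> \<omega> * c \<alpha>) w = of_real \<sigma> * (\<Sum>\<alpha>\<in>?I. a \<alpha> * \<gamma> \<alpha> \<omega>)"
        using \<sigma> by (simp add: poly_fun_def a_def sum_distrib_left mult_ac)
      then show ?thesis using \<sigma> by (simp add: f_def norm_mult)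
    qed
    have "emeasure P {\<omega> \<in> space P. (B + 2 + s\<^sup>2) * real k powr (1 / r) \<le> cmod (\<Sum>\<alpha>\<in>?I. a \<alpha> * \<gamma> \<alpha> \<omega>)}
      \<le> ennreal (4 * exp (- real k))"
    proof (rule tail_sum[OF finI ind _ r _ B(1) a k])
      show "(\<integral>\<^sup>+ \<omega>. ennreal (exp (Re (z * \<gamma> \<alpha> \<omega>))) \<partial>P) \<le> ennreal (exp (s\<^sup>2 * (cmod z)\<^sup>2 / 2))"
        if "\<alpha> \<in> ?I" for \<alpha> z
        using that I by (intro subgaussian_mgf sub s) auto
      show "AE \<omega> in P. \<forall>\<alpha>\<in>?I. cmod (\<gamma> \<alpha> \<omega>) \<le> B" if "r > 2"
        using that I finI B(2) by (intro AE_finite_allI) auto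
    qed
    moreover have "D * \<sigma> * x \<le> f w \<omega> \<longleftrightarrow> D * x \<le> cmod (\<Sum>\<alpha>\<in>?I. a \<alpha> * \<gamma> \<alpha> \<omega>)" for x \<omega>
      using \<sigma> mult_le_cancel_left_pos[of \<sigma> "D * x" "cmod (\<Sum>\<alpha>\<in>?I. a \<alpha> * \<gamma> \<alpha> \<omega>)"]
      unfolding f by (simp only: mult_ac)
    ultimately show "emeasure P {\<omega> \<in> space P. D * \<sigma> * real k powr (1 / r) \<le> f w \<omega>} \<le> ennreal (4 * exp (- real k))"
      by (simp add: D_def)
  qed (use D \<sigma> r fm in \<open>auto simp: f_def\<close>)
  have "orlicz_norm r P (\<lambda>\<omega>. SUP z\<in>unit_ball n N. cmod (poly_fun n m (\<lambda>\<alpha>. \<gamma> \<alpha> \<omega> * c \<alpha>) z))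
      \<le> ennreal (2 * (D * \<sigma>) * (2 * real q) powr (1 / r))"
  proof (rule orlicz_norm_max[OF F(1,2) _ _ _ _ moment _ q(1,2)])
    show "f w \<in> borel_measurable P" for w by (rule fm)
    show "0 \<le> f w \<omega>" for w \<omega> by (simp add: f_def)
    show "0 < D * \<sigma>" "0 < r" using D \<sigma> r by auto
    show "\<bar>SUP z\<in>unit_ball n N. cmod (poly_fun n m (\<lambda>\<alpha>. \<gamma> \<alpha> \<omega> * c \<alpha>) z)\<bar> \<le> 2 * (MAX w\<in>F. f w \<omega>)" for \<omega>
      unfolding f_def using zero_in_ball F(5) by (intro cSup_abs_le) auto
  qed
  also have "\<dots> \<le> ennreal (76 * D * (real n * (1 + ln (real m))) powr (1 / r) * \<sigma>)"
  proof (rule ennreal_leI)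
    define y where "y = real n * (1 + ln (real m))"
    have y: "0 \<le> y" using m unfolding y_def by (intro mult_nonneg_nonneg) auto
    \<comment> \<open>From \<open>2 * q \<le> 38 * y\<close> and \<open>1 / r \<le> 1\<close> the
      factor 38 can be taken out of the root; doubled, it is the 76.\<close>
    have "(2 * real q) powr (1 / r) \<le> (38 * y) powr (1 / r)" using q(3) r y by (intro powr_mono2) (auto simp: y_def)
    also have "\<dots> = 38 powr (1 / r) * y powr (1 / r)" using y by (simp add: powr_mult)
    also have "\<dots> \<le> 38 powr 1 * y powr (1 / r)" using r by (intro mult_right_mono powr_mono) auto
    finally have "(2 * real q) powr (1 / r) \<le> 38 * y powr (1 / r)" by simp
    then have "2 * (D * \<sigma>) * (2 * real q) powr (1 / r) \<le> 2 * (D * \<sigma>) * (38 * y powr (1 / r))"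
      using D \<sigma> by (intro mult_left_mono) auto
    then show "2 * (D * \<sigma>) * (2 * real q) powr (1 / r) \<le> 76 * D * (real n * (1 + ln (real m))) powr (1 / r) * \<sigma>"
      by (simp add: y_def mult_ac)
  qed
  finally show ?thesis by (simp only: D_def)
qed

theorem corollary6p16:
  shows "\<exists>C :: real \<Rightarrow> real \<Rightarrow> real \<Rightarrow> real.
    (\<forall>r s M. C r s M > 0) \<and>
    (\<forall>s M M'. C 2 s M = C 2 s M') \<and>
    (\<forall>(r::real) (r'::real) (s::real) (M::real) (P :: 'a measure) (\<gamma> :: nat list \<Rightarrow> 'a \<Rightarrow> complex).
      2 \<le> r \<longrightarrow> 1 / r + 1 / r' = 1 \<longrightarrow>
      prob_space P \<longrightarrow>
      (\<forall>\<alpha>\<in>multi_indices. subgaussian P (\<gamma> \<alpha>)) \<longrightarrow>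
      prob_space.indep_vars P (\<lambda>_. borel) \<gamma> multi_indices \<longrightarrow>
      (SUP \<alpha>\<in>multi_indices. ereal (sg P (\<gamma> \<alpha>))) = ereal s \<longrightarrow>
      (r > 2 \<longrightarrow> (SUP \<alpha>\<in>multi_indices. Linfty_norm P (\<gamma> \<alpha>)) = ereal M) \<longrightarrow>
      (\<forall>(m::nat) (n::nat) (N :: (nat \<Rightarrow> complex) \<Rightarrow> real) (c :: nat list \<Rightarrow> complex).
        m > 0 \<longrightarrow> n > 0 \<longrightarrow> is_norm n N \<longrightarrow>
        orlicz_norm r P
          (\<lambda>\<omega>. SUP z\<in>unit_ball n N.
             cmod (\<Sum>\<alpha>\<in>{\<alpha>. length \<alpha> = n \<and> sum_list \<alpha> \<le> m}. \<gamma> \<alpha> \<omega> * c \<alpha> * monomial \<alpha> z))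
        \<le> ennreal (C r s M * (real n * (1 + ln (real m))) powr (1 / r) *
            (\<Sum>k=0..m.
               (SUP \<alpha>\<in>{\<alpha>. length \<alpha> = n \<and> sum_list \<alpha> = k}.
                  cmod (c \<alpha>) powr r' * multi_fact \<alpha> / fact k) *
               (SUP z\<in>unit_ball n N. (\<Sum>i<n. cmod (z i) powr r') ^ k)) powr (1 / r'))))"
proof (intro exI[of _ "\<lambda>r s M. 76 * ((if r = 2 then 0 else \<bar>M\<bar>) + 2 + (\<bar>s\<bar> + 1)\<^sup>2)"] conjI allI impI)
  \<comment> \<open>Positivity is demanded at all real arguments, hence the absolute values. The
    added 1 gives a number strictly above every \<open>sg P (\<gamma> \<alpha>)\<close>, as
    \<open>subgaussian_mgf\<close> requires.\<close>
  show "76 * ((if r = 2 then 0 else \<bar>M\<bar>) + 2 + (\<bar>s\<bar> + 1)\<^sup>2) > 0" for r s M :: real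
    by (intro mult_pos_pos add_pos_nonneg add_nonneg_pos) auto
  show "76 * ((if (2::real) = 2 then 0 else \<bar>M\<bar>) + 2 + (\<bar>s\<bar> + 1)\<^sup>2) = 76 * ((if (2::real) = 2 then 0 else \<bar>M'\<bar>) + 2 + (\<bar>s\<bar> + 1)\<^sup>2)"
    for s M M' :: real by simp
next
  fix r r' s M :: real and P :: "'a measure" and \<gamma> :: "nat list \<Rightarrow> 'a \<Rightarrow> complex"
    and m n :: nat and N :: "(nat \<Rightarrow> complex) \<Rightarrow> real" and c :: "nat list \<Rightarrow> complex"
  assume r: "2 \<le> r" "1 / r + 1 / r' = 1" and P: "prob_space P"
    and sub: "\<forall>\<alpha>\<in>multi_indices. subgaussian P (\<gamma> \<alpha>)"
    and indep: "prob_space.indep_vars P (\<lambda>_. borel) \<gamma> multi_indices"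
    and s: "(SUP \<alpha>\<in>multi_indices. ereal (sg P (\<gamma> \<alpha>))) = ereal s"
    and M: "r > 2 \<longrightarrow> (SUP \<alpha>\<in>multi_indices. Linfty_norm P (\<gamma> \<alpha>)) = ereal M"
    and m: "m > 0" and n: "n > 0" and N: "is_norm n N"
  interpret cnorm n N by unfold_locales (rule N)
  define B where "B = (if r = 2 then 0 else \<bar>M\<bar>)"
  define Q where "Q = (\<Sum>k=0..m.
               (SUP \<alpha>\<in>{\<alpha>. length \<alpha> = n \<and> sum_list \<alpha> = k}.
                  cmod (c \<alpha>) powr r' * multi_fact \<alpha> / fact k) *
               (SUP z\<in>unit_ball n N. (\<Sum>i<n. cmod (z i) powr r') ^ k))"
  define K where "K = 76 * (B + 2 + (\<bar>s\<bar> + 1)\<^sup>2) * (real n * (1 + ln (real m))) powr (1 / r)"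
  have "0 < 1 + ln (real m)" using m by (simp add: add_pos_nonneg)
  moreover have "0 < B + 2 + (\<bar>s\<bar> + 1)\<^sup>2"
    by (intro add_pos_nonneg add_nonneg_pos) (auto simp: B_def)
  ultimately have K: "K > 0" unfolding K_def using n by (intro mult_pos_pos) auto
  have "1 / r < 1" using r(1) by simp
  \<comment> \<open>Here \<open>1 / r' = 1 - 1 / r\<close> is positive; this also excludes
    \<open>r' = 0\<close>, where \<open>1 / r'\<close> would be 0.\<close>
  then have r': "r' > 0" using r(2) zero_less_divide_1_iff[of r'] by linarith
  have Q: "(\<Sum>\<alpha>\<in>{\<alpha>. length \<alpha> = n \<and> sum_list \<alpha> \<le> m}. cmod (c \<alpha> * monomial \<alpha> z) powr r') \<le> Q"
    if "z \<in> unit_ball n N" for z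
    unfolding Q_def using r' by (intro coefficient_sum_bound n that) auto
  have "0 \<le> Q" by (rule order_trans[OF _ Q[OF zero_in_ball]]) (intro sum_nonneg, auto)
  have sg_less: "sg P (\<gamma> \<alpha>) < \<bar>s\<bar> + 1" if "\<alpha> \<in> multi_indices" for \<alpha>
  proof -
    have "ereal (sg P (\<gamma> \<alpha>)) \<le> ereal s" unfolding s[symmetric] using that by (rule SUP_upper)
    then show ?thesis by simp
  qed
  have bounded: "AE \<omega> in P. cmod (\<gamma> \<alpha> \<omega>) \<le> B" if "r > 2" "\<alpha> \<in> multi_indices" for \<alpha>
  proof -
    have "Linfty_norm P (\<gamma> \<alpha>) \<le> ereal M" unfolding M[rule_format, OF that(1), symmetric] using that(2) by (rule SUP_upper)
    also have "\<dots> \<le> ereal B" using that(1) by (simp add: B_def)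
    finally have le: "esssup P (\<lambda>\<omega>. ereal (cmod (\<gamma> \<alpha> \<omega>))) \<le> ereal B" by (simp add: Linfty_norm_def)
    have "AE \<omega> in P. ereal (cmod (\<gamma> \<alpha> \<omega>)) \<le> esssup P (\<lambda>\<omega>. ereal (cmod (\<gamma> \<alpha> \<omega>)))" by (rule esssup_AE)
    then show ?thesis
    proof (rule AE_mp, intro AE_I2 impI)
      fix \<omega> assume "ereal (cmod (\<gamma> \<alpha> \<omega>)) \<le> esssup P (\<lambda>\<omega>. ereal (cmod (\<gamma> \<alpha> \<omega>)))"
      from order_trans[OF this le] show "cmod (\<gamma> \<alpha> \<omega>) \<le> B" by simp
    qed
  qed
  have "orlicz_norm r P (\<lambda>\<omega>. SUP z\<in>unit_ball n N. cmod (poly_fun n m (\<lambda>\<alpha>. \<gamma> \<alpha> \<omega> * c \<alpha>) z))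
      \<le> ennreal (K * Q powr (1 / r'))"
    \<comment> \<open>the margin \<open>e\<close> covers \<open>Q = 0\<close>, where one cannot normalise by \<open>Q powr (1 / r')\<close>\<close>
  proof (rule ennreal_le_epsilon)
    fix e :: real assume e: "0 < e"
    define \<sigma> where "\<sigma> = Q powr (1 / r') + e / K"
    have \<sigma>: "\<sigma> > 0" "Q powr (1 / r') \<le> \<sigma>" using e K by (auto simp: \<sigma>_def add_nonneg_pos)
    have "Q = (Q powr (1 / r')) powr r'" using \<open>0 \<le> Q\<close> r' by (simp add: powr_powr)
    also have "\<dots> \<le> \<sigma> powr r'" using \<sigma> r' by (intro powr_mono2) auto
    finally have Q\<sigma>: "Q \<le> \<sigma> powr r'" .
    have "orlicz_norm r P (\<lambda>\<omega>. SUP z\<in>unit_ball n N. cmod (poly_fun n m (\<lambda>\<alpha>. \<gamma> \<alpha> \<omega> * c \<alpha>) z)) \<le> ennreal (K * \<sigma>)"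
      unfolding K_def
    proof (rule random_polynomial_bound[OF r P _ indep sg_less _ bounded m n N \<sigma>(1)])
      show "(\<Sum>\<alpha>\<in>{\<alpha>. length \<alpha> = n \<and> sum_list \<alpha> \<le> m}. cmod (c \<alpha> * monomial \<alpha> z) powr r') \<le> \<sigma> powr r'"
        if "z \<in> unit_ball n N" for z using Q[OF that] Q\<sigma> by (rule order_trans)
    qed (use sub in \<open>auto simp: B_def\<close>)
    also have "K * \<sigma> = K * Q powr (1 / r') + e" using K by (simp add: \<sigma>_def distrib_left)
    also have "ennreal \<dots> = ennreal (K * Q powr (1 / r')) + ennreal e" using K e by (intro ennreal_plus) auto
    finally show "orlicz_norm r P (\<lambda>\<omega>. SUP z\<in>unit_ball n N. cmod (poly_fun n m (\<lambda>\<alpha>. \<gamma> \<alpha> \<omega> * c \<alpha>) z))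
      \<le> ennreal (K * Q powr (1 / r')) + ennreal e" .
  qed
  then show "orlicz_norm r P
          (\<lambda>\<omega>. SUP z\<in>unit_ball n N.
             cmod (\<Sum>\<alpha>\<in>{\<alpha>. length \<alpha> = n \<and> sum_list \<alpha> \<le> m}. \<gamma> \<alpha> \<omega> * c \<alpha> * monomial \<alpha> z))
        \<le> ennreal (76 * ((if r = 2 then 0 else \<bar>M\<bar>) + 2 + (\<bar>s\<bar> + 1)\<^sup>2) * (real n * (1 + ln (real m))) powr (1 / r) *
            (\<Sum>k=0..m.
               (SUP \<alpha>\<in>{\<alpha>. length \<alpha> = n \<and> sum_list \<alpha> = k}.
                  cmod (c \<alpha>) powr r' * multi_fact \<alpha> / fact k) *
               (SUP z\<in>unit_ball n N. (\<Sum>i<n. cmod (z i) powr r') ^ k)) powr (1 / r'))"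
    unfolding poly_fun_def K_def B_def Q_def .
qed

end
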